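(* Let $(V,Y,\mathbf{1},\mathrm{T})$ be a vertex algebra in dimension $D$ (including $D=1$) and let $X\in\operatorname{End}V$. The following two conditions are equivalent: (i) $X$ is a local endomorphism of $V$, $X\mathbf{1}=0$, and $\bigl(e^{-\operatorname{ad}(\mathrm z\cdot\mathrm T)}X\bigr)a\in V[\mathrm z]$ for every $a\in V$; (ii) there is a linear map $X(\mathrm z)\colon V\to V[\mathrm z]$ such that $X(0)=X$ and $[X,Y(a,\mathrm z)]=Y(X(\mathrm z)a,\mathrm z)$ for all $a\in V$. Moreover, in either case $X(\mathrm z)=e^{-\operatorname{ad}(\mathrm z\cdot\mathrm T)}X$, so that $$[X,Y(a,\mathrm z)]=Y\bigl((e^{-\operatorname{ad}(\mathrm z\cdot\mathrm T)}X)a,\mathrm z\bigr)\quad\text{for all }a\in V.$$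
   Context: All vector spaces are complex superspaces; brackets denote supercommutators, e.g. $[X,Y(a,\mathrm z)]=XY(a,\mathrm z)-(-1)^{p_Xp_a}Y(a,\mathrm z)X$ with $p$ denoting parity. $\mathrm z=(z^1,\dots,z^D)$ is a vector of formal variables, $\mathrm z\cdot\mathrm w=\sum_\alpha z^\alpha w^\alpha$, $\mathrm z^2=\mathrm z\cdot\mathrm z$. $V[\![\mathrm z]\!]_{\mathrm z^2}$ denotes the space of series $(\mathrm z^2)^{-N}v(\mathrm z)$ with $v(\mathrm z)\in V[\![\mathrm z]\!]$, $N\in\mathbb Z_{\ge0}$ (similarly $V[\![\mathrm z,\mathrm w]\!]_{\mathrm z^2\mathrm w^2}$); for $D=1$ this is $V(\!(z)\!)$. A vertex algebra in dimension $D$ is a vector superspace $V$ with an even linear map $a\otimes b\mapsto Y(a,\mathrm z)b$, $V\otimes V\to V[\![\mathrm z]\!]_{\mathrm z^2}$, commuting even endomorphisms $T_1,\dots,T_D$ (write $\mathrm T=(T_1,\dots,T_D)$, $\mathrm z\cdot\mathrm T=\sum z^\alpha T_\alpha$), and an even vector $\mathbf 1$, such that: (a) locality: for all $a,b$ there is $N_{a,b}=N_{b,a}\in\mathbb Z_{\ge0}$ with $f_{a,b,c}(\mathrm z,\mathrm w):=((\mathrm z-\mathrm w)^2)^{N_{a,b}}Y(a,\mathrm z)Y(b,\mathrm w)c\in V[\![\mathrm z,\mathrm w]\!]_{\mathrm z^2\mathrm w^2}$ and $f_{a,b,c}(\mathrm z,\mathrm w)=(-1)^{p_ap_b}f_{b,a,c}(\mathrm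 w,\mathrm z)$ for all $c$; (b) translation covariance: $[T_\alpha,Y(a,\mathrm z)]=\partial_{z^\alpha}Y(a,\mathrm z)$; (c) vacuum: $T_\alpha\mathbf 1=0$, $Y(\mathbf 1,\mathrm z)a=a$, $Y(a,\mathrm z)\mathbf 1\in V[\![\mathrm z]\!]$ and $Y(a,\mathrm z)\mathbf 1|_{\mathrm z=0}=a$. For $D=1$ this is the usual (Borcherds) vertex algebra. A linear operator $X\in\operatorname{End}V$ is called local if for all $a,b\in V$ there is $N\in\mathbb Z_{\ge0}$ with $((\mathrm z-\mathrm w)^2)^{N}\bigl[[X,Y(a,\mathrm z)],Y(b,\mathrm w)\bigr]=0$. Here $e^{-\operatorname{ad}(\mathrm z\cdot\mathrm T)}X:=\sum_{k\ge0}\frac{(-1)^k}{k!}(\operatorname{ad}(\mathrm z\cdot\mathrm T))^kX\in(\operatorname{End}V)[\![\mathrm z]\!]$. *)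

theory Defs
  imports Complex_Main
begin

text \<open>The coordinates are indexed by a finite type 'd, so D = CARD('d) (D = 1 included).
  A multi-index is a function 'd => nat; a series in V[[z]] is a function from multi-indices
  to V. For two sets of variables (z,w) we use the index type 'd + 'd (Inl = z, Inr = w).\<close>

type_synonym 'i mi = "'i \<Rightarrow> nat"

definition mi0 :: "'i mi" where "mi0 = (\<lambda>_. 0)"
definition mi_delta :: "'i \<Rightarrow> 'i mi" where "mi_delta i = (\<lambda>j. if j = i then 1 else 0)"
definition mi_sub :: "'i mi \<Rightarrow> 'i mi \<Rightarrow> 'i mi" where "mi_sub n m = (\<lambda>i. n i - m i)"
definition mi_join :: "'d mi \<Rightarrow> 'd mi \<Rightarrow> ('d + 'd) mi" where "mi_join e n = case_sum e n"

definition smono :: "'i mi \<Rightarrow> 'i mi \<Rightarrow> complex" where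
  "smono e = (\<lambda>m. if m = e then 1 else 0)"

definition ss_mult :: "('i mi \<Rightarrow> complex) \<Rightarrow> ('i mi \<Rightarrow> complex) \<Rightarrow> 'i mi \<Rightarrow> complex" where
  "ss_mult p q = (\<lambda>n. \<Sum>m\<in>{m. m \<le> n}. p m * q (mi_sub n m))"

definition ss_pow :: "('i mi \<Rightarrow> complex) \<Rightarrow> nat \<Rightarrow> 'i mi \<Rightarrow> complex" where
  "ss_pow p k = (ss_mult p ^^ k) (smono mi0)"

definition ssq :: "'i set \<Rightarrow> 'i mi \<Rightarrow> complex" where
  "ssq S = (\<lambda>n. \<Sum>i\<in>S. smono (\<lambda>j. if j = i then 2 else 0) n)"

definition zsq :: "('d::finite) mi \<Rightarrow> complex" where "zsq = ssq UNIV"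
definition xsq :: "('d::finite + 'd) mi \<Rightarrow> complex" where "xsq = ssq (range Inl)"
definition ysq :: "('d::finite + 'd) mi \<Rightarrow> complex" where "ysq = ssq (range Inr)"
definition xysq :: "('d::finite + 'd) mi \<Rightarrow> complex" where "xysq = ss_mult xsq ysq"
definition xydiff_sq :: "('d::finite + 'd) mi \<Rightarrow> complex" where
  "xydiff_sq = (\<lambda>n. \<Sum>\<alpha>\<in>UNIV.
      ss_pow (\<lambda>m. smono (mi_delta (Inl \<alpha>)) m - smono (mi_delta (Inr \<alpha>)) m) 2 n)"

definition cmul :: "(complex \<Rightarrow> 'v \<Rightarrow> 'v) \<Rightarrow> ('i mi \<Rightarrow> complex) \<Rightarrow> ('i mi \<Rightarrow> 'v::ab_group_add)
    \<Rightarrow> 'i mi \<Rightarrow> 'v" where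
  "cmul smul p f = (\<lambda>n. \<Sum>m\<in>{m. m \<le> n}. smul (p m) (f (mi_sub n m)))"

text \<open>A pair (N, f) represents (z^2)^(-N) f(z), f in V[[z]]. Equality in the localisation is
  the relation ls_eq.\<close>

type_synonym ('d,'v) ls = "nat \<times> ('d mi \<Rightarrow> 'v)"

definition ls_eq :: "(complex \<Rightarrow> 'v \<Rightarrow> 'v) \<Rightarrow> ('d::finite,'v::ab_group_add) ls \<Rightarrow> ('d,'v) ls \<Rightarrow> bool" where
  "ls_eq smul u v \<longleftrightarrow>
     (\<exists>k. cmul smul (ss_pow zsq (fst v + k)) (snd u) = cmul smul (ss_pow zsq (fst u + k)) (snd v))"

definition ls_add :: "(complex \<Rightarrow> 'v \<Rightarrow> 'v) \<Rightarrow> ('d::finite,'v::ab_group_add) ls \<Rightarrow> ('d,'v) ls \<Rightarrow> ('d,'v) ls" where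
  "ls_add smul u v = (fst u + fst v,
     \<lambda>n. cmul smul (ss_pow zsq (fst v)) (snd u) n + cmul smul (ss_pow zsq (fst u)) (snd v) n)"

definition ls_scale :: "(complex \<Rightarrow> 'v \<Rightarrow> 'v) \<Rightarrow> complex \<Rightarrow> ('d,'v) ls \<Rightarrow> ('d,'v) ls" where
  "ls_scale smul c u = (fst u, \<lambda>n. smul c (snd u n))"

definition ls_map :: "('v \<Rightarrow> 'v) \<Rightarrow> ('d,'v) ls \<Rightarrow> ('d,'v) ls" where
  "ls_map \<phi> u = (fst u, \<lambda>n. \<phi> (snd u n))"

definition ls_cmul :: "(complex \<Rightarrow> 'v \<Rightarrow> 'v) \<Rightarrow> ('d mi \<Rightarrow> complex) \<Rightarrow> ('d,'v::ab_group_add) ls \<Rightarrow> ('d,'v) ls" where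
  "ls_cmul smul p u = (fst u, cmul smul p (snd u))"

definition ls_sum :: "(complex \<Rightarrow> 'v \<Rightarrow> 'v) \<Rightarrow> 'a set \<Rightarrow> ('a \<Rightarrow> ('d::finite,'v::ab_group_add) ls) \<Rightarrow> ('d,'v) ls" where
  "ls_sum smul S \<phi> = (let Nm = Max (insert 0 ((\<lambda>s. fst (\<phi> s)) ` S)) in
     (Nm, \<lambda>n. \<Sum>s\<in>S. cmul smul (ss_pow zsq (Nm - fst (\<phi> s))) (snd (\<phi> s)) n))"

text \<open>Partial derivative d/dz^alpha of (z^2)^(-N) f = (z^2)^(-N-1) (z^2 d f - 2 N z^alpha f).\<close>
definition ls_deriv :: "(complex \<Rightarrow> 'v \<Rightarrow> 'v) \<Rightarrow> 'd \<Rightarrow> ('d::finite,'v::ab_group_add) ls \<Rightarrow> ('d,'v) ls" where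
  "ls_deriv smul \<alpha> u = (Suc (fst u),
     \<lambda>n. cmul smul zsq (\<lambda>m. smul (of_nat (m \<alpha> + 1)) (snd u (m(\<alpha> := m \<alpha> + 1)))) n
         - smul (of_nat (2 * fst u)) (cmul smul (smono (mi_delta \<alpha>)) (snd u) n))"

text \<open>(V[[z]]_{z^2})[[w]]_{w^2}: a pair (M, F) represents (w^2)^(-M) sum_m w^m F m with
  F m in V[[z]]_{z^2}. Elements of V[[z,w]]_{z^2 w^2} are pairs (K, h), h :: ('d+'d) mi => V,
  representing (z^2 w^2)^(-K) h(z,w).\<close>

type_synonym ('d,'v) wls = "nat \<times> ('d mi \<Rightarrow> ('d,'v) ls)"

text \<open>Coefficient of w^n in c(z,w) * sum_m w^m F m, for a scalar series c in (z,w).\<close>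
definition wcoef :: "(complex \<Rightarrow> 'v \<Rightarrow> 'v) \<Rightarrow> (('d::finite + 'd) mi \<Rightarrow> complex)
    \<Rightarrow> ('d mi \<Rightarrow> ('d,'v::ab_group_add) ls) \<Rightarrow> 'd mi \<Rightarrow> ('d,'v) ls" where
  "wcoef smul c F n = ls_sum smul {e'. e' \<le> n}
      (\<lambda>e'. ls_cmul smul (\<lambda>e. c (mi_join e e')) (F (mi_sub n e')))"

definition wadd :: "(complex \<Rightarrow> 'v \<Rightarrow> 'v) \<Rightarrow> ('d::finite,'v::ab_group_add) wls \<Rightarrow> ('d,'v) wls \<Rightarrow> ('d,'v) wls" where
  "wadd smul W1 W2 = (fst W1 + fst W2,
     \<lambda>n. ls_add smul (wcoef smul (ss_pow ysq (fst W2)) (snd W1) n)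
                      (wcoef smul (ss_pow ysq (fst W1)) (snd W2) n))"

definition eq2 :: "(complex \<Rightarrow> 'v \<Rightarrow> 'v) \<Rightarrow> nat \<times> (('d::finite + 'd) mi \<Rightarrow> 'v::ab_group_add)
    \<Rightarrow> nat \<times> (('d + 'd) mi \<Rightarrow> 'v) \<Rightarrow> bool" where
  "eq2 smul u v \<longleftrightarrow>
     (\<exists>k. cmul smul (ss_pow xysq (fst v + k)) (snd u) = cmul smul (ss_pow xysq (fst u + k)) (snd v))"

text \<open>lands smul L W K h: ((z-w)^2)^L * W = (z^2 w^2)^(-K) h(z,w), as an identity in
  (V[[z]]_{z^2})[[w]]_{w^2}; in particular ((z-w)^2)^L W lies in V[[z,w]]_{z^2 w^2}.\<close>
definition lands :: "(complex \<Rightarrow> 'v \<Rightarrow> 'v) \<Rightarrow> nat \<Rightarrow> ('d::finite,'v::ab_group_add) wls \<Rightarrow> nat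
    \<Rightarrow> (('d + 'd) mi \<Rightarrow> 'v) \<Rightarrow> bool" where
  "lands smul L W K h \<longleftrightarrow> (\<exists>k. \<forall>n.
     ls_eq smul (wcoef smul (ss_mult (ss_pow xydiff_sq L) (ss_pow ysq (K + k))) (snd W) n)
                (K, \<lambda>e. cmul smul (ss_pow ysq (fst W + k)) h (mi_join e n)))"

definition swp :: "(('d + 'd) mi \<Rightarrow> 'v) \<Rightarrow> ('d + 'd) mi \<Rightarrow> 'v" where
  "swp h = (\<lambda>m. h (m \<circ> case_sum Inr Inl))"

definition prod2 :: "('v \<Rightarrow> ('d,'v) ls) \<Rightarrow> ('v \<Rightarrow> ('d,'v) ls) \<Rightarrow> 'v \<Rightarrow> ('d,'v) wls" where
  "prod2 A B c = (fst (B c), \<lambda>m. A (snd (B c) m))"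

text \<open>A superspace structure on the complex vector space V is given by the (linear, idempotent)
  projection P onto the even part V_0 along the odd part V_1. sgr P is the parity operator
  (+1 on V_0, -1 on V_1).\<close>

definition is_superspace :: "(complex \<Rightarrow> 'v::ab_group_add \<Rightarrow> 'v) \<Rightarrow> ('v \<Rightarrow> 'v) \<Rightarrow> bool" where
  "is_superspace smul P \<longleftrightarrow> vector_space smul \<and> Vector_Spaces.linear smul smul P \<and> (\<forall>v. P (P v) = P v)"

definition sgr :: "('v \<Rightarrow> 'v) \<Rightarrow> 'v \<Rightarrow> 'v::ab_group_add" where "sgr P v = P v - (v - P v)"

definition is_even :: "('v \<Rightarrow> 'v) \<Rightarrow> 'v \<Rightarrow> bool" where "is_even P a \<longleftrightarrow> P a = a"
definition is_odd :: "('v \<Rightarrow> 'v) \<Rightarrow> 'v::zero \<Rightarrow> bool" where "is_odd P a \<longleftrightarrow> P a = 0"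

definition op_even :: "(complex \<Rightarrow> 'v \<Rightarrow> 'v) \<Rightarrow> ('v \<Rightarrow> 'v) \<Rightarrow> ('v \<Rightarrow> 'v) \<Rightarrow> 'v \<Rightarrow> 'v::ab_group_add" where
  "op_even smul P X v = smul (1/2) (X v + sgr P (X (sgr P v)))"
definition op_odd :: "(complex \<Rightarrow> 'v \<Rightarrow> 'v) \<Rightarrow> ('v \<Rightarrow> 'v) \<Rightarrow> ('v \<Rightarrow> 'v) \<Rightarrow> 'v \<Rightarrow> 'v::ab_group_add" where
  "op_odd smul P X v = smul (1/2) (X v - sgr P (X (sgr P v)))"

definition fld_even :: "(complex \<Rightarrow> 'v \<Rightarrow> 'v) \<Rightarrow> ('v \<Rightarrow> 'v) \<Rightarrow> ('v \<Rightarrow> ('d::finite,'v::ab_group_add) ls) \<Rightarrow> 'v \<Rightarrow> ('d,'v) ls" where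
  "fld_even smul P A c = ls_scale smul (1/2) (ls_add smul (A c) (ls_map (sgr P) (A (sgr P c))))"
definition fld_odd :: "(complex \<Rightarrow> 'v \<Rightarrow> 'v) \<Rightarrow> ('v \<Rightarrow> 'v) \<Rightarrow> ('v \<Rightarrow> ('d::finite,'v::ab_group_add) ls) \<Rightarrow> 'v \<Rightarrow> ('d,'v) ls" where
  "fld_odd smul P A c = ls_scale smul (1/2)
      (ls_add smul (A c) (ls_scale smul (-1) (ls_map (sgr P) (A (sgr P c)))))"
text \<open>B_0 - B_1 for a field B.\<close>
definition fld_conj :: "('v \<Rightarrow> 'v) \<Rightarrow> ('v \<Rightarrow> ('d,'v::ab_group_add) ls) \<Rightarrow> 'v \<Rightarrow> ('d,'v) ls" where
  "fld_conj P B v = ls_map (sgr P) (B (sgr P v))"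

text \<open>Supercommutator [X, A(z)] c of an endomorphism X with a field A, extended bilinearly from
  homogeneous X, A: X A c - sum_{i,j} (-1)^{ij} A_j X_i c = X A c - (A X_0 c + (A_0 - A_1) X_1 c).\<close>
definition scomm :: "(complex \<Rightarrow> 'v \<Rightarrow> 'v) \<Rightarrow> ('v \<Rightarrow> 'v) \<Rightarrow> ('v \<Rightarrow> 'v)
    \<Rightarrow> ('v \<Rightarrow> ('d::finite,'v::ab_group_add) ls) \<Rightarrow> 'v \<Rightarrow> ('d,'v) ls" where
  "scomm smul P X A c = ls_add smul (ls_map X (A c))
     (ls_scale smul (-1) (ls_add smul (A (op_even smul P X c))
                                       (ls_map (sgr P) (A (sgr P (op_odd smul P X c))))))"

text \<open>Super-signed reversed product sum_{i,j} (-1)^{ij} B_j(w) A_i(z) c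
  = B(w) A_0(z) c + (B_0 - B_1)(w) A_1(z) c, an element of (V[[w]]_{w^2})[[z]]_{z^2}.\<close>
definition sprod_swap :: "(complex \<Rightarrow> 'v \<Rightarrow> 'v) \<Rightarrow> ('v \<Rightarrow> 'v) \<Rightarrow> ('v \<Rightarrow> ('d::finite,'v::ab_group_add) ls)
    \<Rightarrow> ('v \<Rightarrow> ('d,'v) ls) \<Rightarrow> 'v \<Rightarrow> ('d,'v) wls" where
  "sprod_swap smul P B A c =
     wadd smul (prod2 B (fld_even smul P A) c) (prod2 (fld_conj P B) (fld_odd smul P A) c)"

definition vertex_algebra :: "(complex \<Rightarrow> 'v \<Rightarrow> 'v) \<Rightarrow> ('v \<Rightarrow> 'v) \<Rightarrow> ('v \<Rightarrow> 'v \<Rightarrow> ('d::finite,'v::ab_group_add) ls)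
    \<Rightarrow> ('d \<Rightarrow> 'v \<Rightarrow> 'v) \<Rightarrow> 'v \<Rightarrow> bool" where
  "vertex_algebra smul P Y T vac \<longleftrightarrow>
     is_superspace smul P \<and>
     \<comment> \<open>Y is an even bilinear map V x V -> V[[z]]_{z^2}\<close>
     (\<forall>a a' b. ls_eq smul (Y (a + a') b) (ls_add smul (Y a b) (Y a' b))) \<and>
     (\<forall>c a b. ls_eq smul (Y (smul c a) b) (ls_scale smul c (Y a b))) \<and>
     (\<forall>a b b'. ls_eq smul (Y a (b + b')) (ls_add smul (Y a b) (Y a b'))) \<and>
     (\<forall>c a b. ls_eq smul (Y a (smul c b)) (ls_scale smul c (Y a b))) \<and>
     (\<forall>a b. ls_eq smul (Y (sgr P a) (sgr P b)) (ls_map (sgr P) (Y a b))) \<and>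
     \<comment> \<open>commuting even endomorphisms T_alpha, even vacuum\<close>
     (\<forall>\<alpha>. Vector_Spaces.linear smul smul (T \<alpha>) \<and> (\<forall>v. T \<alpha> (sgr P v) = sgr P (T \<alpha> v))) \<and>
     (\<forall>\<alpha> \<beta> v. T \<alpha> (T \<beta> v) = T \<beta> (T \<alpha> v)) \<and>
     is_even P vac \<and>
     \<comment> \<open>(a) locality\<close>
     (\<forall>a b. (is_even P a \<or> is_odd P a) \<longrightarrow> (is_even P b \<or> is_odd P b) \<longrightarrow>
        (\<exists>N. \<forall>c. \<exists>K h K' h'.
           lands smul N (prod2 (Y a) (Y b) c) K h \<and>
           lands smul N (prod2 (Y b) (Y a) c) K' h' \<and>
           eq2 smul (K, h)
             (K', \<lambda>m. smul (if is_odd P a \<and> is_odd P b then -1 else 1)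
                          (swp h' m)))) \<and>
     \<comment> \<open>(b) translation covariance\<close>
     (\<forall>\<alpha> a b. ls_eq smul (scomm smul P (T \<alpha>) (Y a) b) (ls_deriv smul \<alpha> (Y a b))) \<and>
     \<comment> \<open>(c) vacuum\<close>
     (\<forall>\<alpha>. T \<alpha> vac = 0) \<and>
     (\<forall>a. ls_eq smul (Y vac a) (0, \<lambda>n. if n = mi0 then a else 0)) \<and>
     (\<forall>a. \<exists>g. ls_eq smul (Y a vac) (0, g) \<and> g mi0 = a)"

text \<open>X is local: for all a, b there is N with ((z-w)^2)^N [[X,Y(a,z)],Y(b,w)] = 0, i.e.
  ((z-w)^2)^N [X,Y(a,z)] Y(b,w) c and ((z-w)^2)^N sum (-1)^{ij} Y(b,w)_j [X,Y(a,z)]_i c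
  coincide (as elements of V[[z,w]]_{z^2 w^2}) for all c.\<close>
definition local_op :: "(complex \<Rightarrow> 'v \<Rightarrow> 'v) \<Rightarrow> ('v \<Rightarrow> 'v) \<Rightarrow> ('v \<Rightarrow> 'v \<Rightarrow> ('d::finite,'v::ab_group_add) ls)
    \<Rightarrow> ('v \<Rightarrow> 'v) \<Rightarrow> bool" where
  "local_op smul P Y X \<longleftrightarrow> (\<forall>a b. \<exists>N. \<forall>c. \<exists>K h.
     lands smul N (prod2 (scomm smul P X (Y a)) (Y b) c) K h \<and>
     lands smul N (sprod_swap smul P (Y b) (scomm smul P X (Y a)) c) K (swp h))"

text \<open>ad(z.T) on (End V)[[z]] (z.T is even, so the supercommutator is the commutator).\<close>
definition adzT :: "('d::finite \<Rightarrow> 'v \<Rightarrow> 'v) \<Rightarrow> ('d mi \<Rightarrow> 'v \<Rightarrow> 'v::ab_group_add) \<Rightarrow> 'd mi \<Rightarrow> 'v \<Rightarrow> 'v" where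
  "adzT T F n v = (\<Sum>\<alpha>\<in>{\<alpha>. 1 \<le> n \<alpha>}.
      T \<alpha> (F (mi_sub n (mi_delta \<alpha>)) v) - F (mi_sub n (mi_delta \<alpha>)) (T \<alpha> v))"

text \<open>Coefficient of z^n in e^{-ad(z.T)} X = sum_k (-1)^k/k! (ad(z.T))^k X; the k-th term is
  homogeneous of degree k, so only k <= |n| can contribute to the coefficient of z^n.\<close>
definition exp_ad :: "(complex \<Rightarrow> 'v \<Rightarrow> 'v) \<Rightarrow> ('d::finite \<Rightarrow> 'v \<Rightarrow> 'v) \<Rightarrow> ('v \<Rightarrow> 'v::ab_group_add)
    \<Rightarrow> 'd mi \<Rightarrow> 'v \<Rightarrow> 'v" where
  "exp_ad smul T X n v = (\<Sum>k\<in>{..(\<Sum>\<alpha>\<in>UNIV. n \<alpha>)}.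
      smul ((-1) ^ k / of_nat (fact k)) (((adzT T) ^^ k) (\<lambda>m. if m = mi0 then X else (\<lambda>_. 0)) n v))"

definition Ysub :: "(complex \<Rightarrow> 'v \<Rightarrow> 'v) \<Rightarrow> ('v \<Rightarrow> 'v \<Rightarrow> ('d::finite,'v::ab_group_add) ls)
    \<Rightarrow> ('d mi \<Rightarrow> 'v) \<Rightarrow> 'v \<Rightarrow> ('d,'v) ls" where
  "Ysub smul Y g b = ls_sum smul {n. g n \<noteq> 0} (\<lambda>n. ls_cmul smul (smono n) (Y (g n) b))"

end

theory Submission
  imports Defs "HOL-Library.Function_Algebras" "HOL-Library.FuncSet"
begin

text \<open>A field that is local with respect to all \<open>Y(b,w)\<close> is determined by its value on the vacuum: if
  \<open>C(z)\<close> is local and kills \<open>1\<close>, then \<open>((z-w)^2)^N C(z) Y(b,w) 1 = 0\<close>, and the lowest order term at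
  \<open>w = 0\<close> gives \<open>(z^2)^N C(z) b = 0\<close>. For (i) to (ii), this is applied to the difference of \<open>[X, Y(a,z)]\<close>
  and \<open>Y(X(z)a, z)\<close> with \<open>X(z) = e^{-ad(z.T)} X\<close>; the latter is local because it is a finite sum of
  \<open>z^n Y(x,z)\<close>. On the vacuum both fields give \<open>X e^{z.T} a = e^{z.T} X(z) a\<close>. Conversely, (ii) evaluated on
  the vacuum yields first \<open>X 1 = 0\<close> and then \<open>e^{z.T} X(z) a = X e^{z.T} a\<close>, which determines \<open>X(z)\<close>.\<close>

section \<open>Multi-indices\<close>

text \<open>The obstacle is that fields take values in fractions compared only up to
  \<open>ls_eq\<close>, and \<open>Y\<close> is linear only in that sense. Each fraction is
  therefore replaced by its numerators over (z^2)^N: equivalence becomes equality for all large N,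
  and nothing is lost because multiplication by z^2 is injective. In a product of two fields the
  required N may grow with the power of w; a denominator common to all powers of w is guaranteed
  only after multiplication by the locality factor. Neither X nor a is assumed homogeneous, so the
  reversed product is split by the parity of the field moved across. The cancellation on the vacuum
  survives this splitting because 1 is even: the parity parts of A(z)1 depend on A(z)1 alone.
  Exponentials are handled through differential equations. The relations d_alpha X(z) =
  -[T_alpha, X(z)] and d_alpha E(z) = T_alpha E(z), with E(z) = e^{z.T}, determine all coefficients
  recursively, since n alpha + 1 is invertible over the complex numbers.\<close>

lemma mi_sub_eq: "mi_sub n m = n - m"
  by (simp add: mi_sub_def fun_diff_def)

lemma mi0_eq: "mi0 = 0"
  by (simp add: mi0_def zero_fun_def)

lemma mi_delta_apply [simp]: "mi_delta a b = (if b = a then 1 else 0)"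
  by (simp add: mi_delta_def)

lemma finite_mi_le [simp]: "finite {m. m \<le> (n :: 'i::finite mi)}"
proof -
  have "{m. m \<le> n} \<subseteq> PiE UNIV (\<lambda>i. {..n i})"
    by (auto simp: le_fun_def PiE_iff)
  then show ?thesis by (rule finite_subset) (auto intro: finite_PiE)
qed

lemma mi_le_diff [simp]: "n - m \<le> (n :: 'i mi)"
  by (simp add: le_fun_def)

lemma mi_le_add [simp]: "n \<le> n + (m :: 'i mi)" "n \<le> m + (n :: 'i mi)"
  by (simp_all add: le_fun_def)

lemma mi_add_diff [simp]: "m \<le> n \<Longrightarrow> m + (n - m) = (n :: 'i mi)"
  "m \<le> n \<Longrightarrow> (n - m) + m = (n :: 'i mi)"
  by (simp_all add: le_fun_def fun_eq_iff)

lemma mi_diff_diff [simp]: "m \<le> n \<Longrightarrow> n - (n - m) = (m :: 'i mi)"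
  by (simp add: le_fun_def fun_eq_iff)

lemma mi_add_diff_cancel [simp]: "(m + n) - n = (m :: 'i mi)" "(n + m) - n = (m :: 'i mi)"
  by (simp_all add: fun_eq_iff)

lemma mi_diff_diff_left: "(n - m) - k = (n - (m + k) :: 'i mi)"
  by (simp add: fun_eq_iff)

lemma mi_diff_zero [simp]: "n - 0 = (n :: 'i mi)"
  by (simp add: fun_eq_iff)

lemma mi_zero_le [simp]: "0 \<le> (n :: 'i mi)"
  by (simp add: le_fun_def)

lemma mi_le_zero [simp]: "n \<le> 0 \<longleftrightarrow> n = (0 :: 'i mi)"
  by (simp add: le_fun_def fun_eq_iff)

lemma mi_le_diff_iff: "m \<le> n \<Longrightarrow> k \<le> n - m \<longleftrightarrow> m + k \<le> (n :: 'i mi)"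
  by (simp add: le_fun_def le_diff_conv2 add.commute)

lemma mi_delta_le_iff: "mi_delta a \<le> n \<longleftrightarrow> 1 \<le> n a"
  by (auto simp: le_fun_def)

lemma mi_diff_delta_add: "1 \<le> n a \<Longrightarrow> n - mi_delta a + mi_delta a = n"
  by (simp add: mi_delta_le_iff)

lemma mi_upd_eq: "m(a := m a + 1) = m + mi_delta a"
  by (auto simp: fun_eq_iff)

definition mi_deg :: "'i::finite mi \<Rightarrow> nat" where "mi_deg n = (\<Sum>i\<in>UNIV. n i)"

lemma mi_deg_add: "mi_deg (m + n) = mi_deg m + mi_deg n"
  by (simp add: mi_deg_def sum.distrib)

lemma mi_deg_delta [simp]: "mi_deg (mi_delta a) = 1"
  by (simp add: mi_deg_def)

lemma mi_deg_zero [simp]: "mi_deg 0 = 0"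
  by (simp add: mi_deg_def)

lemma mi_deg_eq_0: "mi_deg n = 0 \<longleftrightarrow> n = 0"
  by (auto simp: mi_deg_def fun_eq_iff)

lemma mi_induct [case_names zero add]:
  assumes "P 0" "\<And>m a. P m \<Longrightarrow> P (m + mi_delta a)"
  shows "P (n :: 'i::finite mi)"
proof (induction "mi_deg n" arbitrary: n)
  case 0
  then show ?case using assms(1) by (metis mi_deg_eq_0)
next
  case (Suc k)
  then obtain a where "1 \<le> n a"
    by (metis (no_types, lifting) One_nat_def Suc_leI mi_deg_def neq0_conv old.nat.distinct(2) sum.neutral)
  then have n: "n = (n - mi_delta a) + mi_delta a" by (simp add: mi_diff_delta_add)
  then have "mi_deg n = mi_deg (n - mi_delta a) + 1"
    by (metis mi_deg_add mi_deg_delta)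
  then have "k = mi_deg (n - mi_delta a)" using Suc by simp
  then show ?case using Suc assms(2) n by metis
qed

lemma sum_mi_flip: "(\<Sum>m\<in>{m. m \<le> n}. f m (n - m)) = (\<Sum>m\<in>{m. m \<le> n}. f (n - m) (m :: 'i::finite mi))"
  by (rule sum.reindex_bij_witness[of _ "\<lambda>m. n - m" "\<lambda>m. n - m"]) auto

text \<open>The three arguments of f are the exponents of three factors. The re-indexing (m, k) to
  (k, m - k) is the whole content of associativity of the Cauchy product.\<close>

lemma sum_mi_assoc:
  "(\<Sum>m\<in>{m. m \<le> n}. \<Sum>k\<in>{k. k \<le> m}. f k (m - k) (n - m))
   = (\<Sum>k\<in>{k. k \<le> n}. \<Sum>l\<in>{l. l \<le> n - k}. f k l (n - k - (l :: 'i::finite mi)))"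
  unfolding sum.Sigma[OF finite_mi_le ballI[OF finite_mi_le]]
  by (rule sum.reindex_bij_witness[of _ "\<lambda>(k,l). (k + l, k)" "\<lambda>(m,k). (k, m - k)"])
    (auto simp: mi_le_diff_iff mi_diff_diff_left dest: order_trans)

lemma sum_fun_apply: "(\<Sum>s\<in>S. f s) x = (\<Sum>s\<in>S. f s x)"
  for f :: "'s \<Rightarrow> 'a \<Rightarrow> 'b::comm_monoid_add"
  by (induction S rule: infinite_finite_induct) simp_all

text \<open>Applied to \<open>mi_delta i\<close> it gives the exponent of the pure power
  (z^i)^j.\<close>

definition mi_scale :: "nat \<Rightarrow> 'i mi \<Rightarrow> 'i mi" where "mi_scale j n = (\<lambda>i. j * n i)"

section \<open>The module of formal power series\<close>

locale complex_vector_space = vector_space smul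
  for smul :: "complex \<Rightarrow> 'v::ab_group_add \<Rightarrow> 'v"
begin

lemma cmul_eq: "cmul smul p f n = (\<Sum>m\<in>{m. m \<le> n}. smul (p m) (f (n - m)))"
  by (simp add: cmul_def mi_sub_eq)

lemma cmul_assoc: "cmul smul (ss_mult p q) f = cmul smul p (cmul smul q (f :: 'i::finite mi \<Rightarrow> 'v))"
proof
  fix n
  have "cmul smul (ss_mult p q) f n
    = (\<Sum>m\<in>{m. m \<le> n}. \<Sum>k\<in>{k. k \<le> m}. smul (p k * q (m - k)) (f (n - m)))"
    by (simp add: cmul_eq ss_mult_def scale_sum_left mi_sub_eq)
  also have "\<dots> = (\<Sum>k\<in>{k. k \<le> n}. \<Sum>l\<in>{l. l \<le> n - k}. smul (p k * q l) (f (n - k - l)))"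
    by (rule sum_mi_assoc)
  also have "\<dots> = cmul smul p (cmul smul q f) n"
    by (simp add: cmul_eq scale_sum_right)
  finally show "cmul smul (ss_mult p q) f n = cmul smul p (cmul smul q f) n" .
qed

lemma cmul_add: "cmul smul p (f + g) = cmul smul p f + cmul smul p (g :: 'i::finite mi \<Rightarrow> 'v)"
  by (rule ext) (simp add: cmul_eq scale_right_distrib sum.distrib)

lemma cmul_diff: "cmul smul p (f - g) = cmul smul p f - cmul smul p (g :: 'i::finite mi \<Rightarrow> 'v)"
  by (rule ext) (simp add: cmul_eq scale_right_diff_distrib sum_subtractf)

lemma cmul_zero [simp]: "cmul smul p 0 = (0 :: 'i::finite mi \<Rightarrow> 'v)"
  by (rule ext) (simp add: cmul_eq)

lemma cmul_sum: "cmul smul p (\<Sum>s\<in>S. f s) = (\<Sum>s\<in>S. cmul smul p (f s :: 'i::finite mi \<Rightarrow> 'v))"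
  by (rule ext) (simp add: cmul_eq sum_fun_apply scale_sum_right, rule sum.swap)

lemma cmul_scale: "cmul smul p (\<lambda>n. smul c (f n)) = (\<lambda>n. smul c (cmul smul p f (n :: 'i::finite mi)))"
  by (rule ext) (simp add: cmul_eq scale_sum_right mult.commute)

lemma cmul_map:
  assumes "Vector_Spaces.linear smul smul \<phi>"
  shows "cmul smul p (\<lambda>n. \<phi> (f n)) = (\<lambda>n. \<phi> (cmul smul p f (n :: 'i::finite mi)))"
proof -
  interpret \<phi>: Vector_Spaces.linear smul smul \<phi> by fact
  show ?thesis by (rule ext) (simp add: cmul_eq \<phi>.sum \<phi>.scale)
qed

lemma cmul_left_sum:
  "cmul smul (\<lambda>m. \<Sum>s\<in>S. p s m) f = (\<lambda>n. \<Sum>s\<in>S. cmul smul (p s) f (n :: 'i::finite mi))"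
  by (rule ext) (simp add: cmul_eq scale_sum_left, rule sum.swap)

lemma cmul_smono: "cmul smul (smono e) f n = (if e \<le> n then f (n - e) else (0 :: 'v))"
  for n :: "'i::finite mi"
proof -
  have "cmul smul (smono e) f n = (\<Sum>m\<in>{m. m \<le> n}. if m = e then f (n - m) else 0)"
    unfolding cmul_eq by (rule sum.cong) (auto simp: smono_def)
  then show ?thesis by (simp add: sum.delta)
qed

lemma cmul_one [simp]: "cmul smul (smono 0) f = (f :: 'i::finite mi \<Rightarrow> 'v)"
  by (rule ext) (simp add: cmul_smono)

end

text \<open>Scalar series are the case V = C, with \<open>ss_mult\<close> as \<open>cmul\<close>;
  the module lemmas thereby also give the ring lemmas.\<close>

interpretation cplx: complex_vector_space "(*) :: complex \<Rightarrow> complex \<Rightarrow> complex"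
  by unfold_locales (simp_all add: algebra_simps)

lemma ss_mult_eq_cmul: "ss_mult = cmul (*)"
  by (intro ext) (simp add: ss_mult_def cmul_def)

lemma ss_mult_commute: "ss_mult p q = ss_mult q (p :: 'i::finite mi \<Rightarrow> complex)"
proof
  fix n
  have "ss_mult p q n = (\<Sum>m\<in>{m. m \<le> n}. p m * q (n - m))"
    by (simp add: ss_mult_def mi_sub_eq)
  also have "\<dots> = (\<Sum>m\<in>{m. m \<le> n}. p (n - m) * q m)"
    by (rule sum_mi_flip)
  finally show "ss_mult p q n = ss_mult q p n"
    by (simp add: ss_mult_def mi_sub_eq mult.commute)
qed

lemma ss_pow_0 [simp]: "ss_pow p 0 = smono 0"
  by (simp add: ss_pow_def mi0_eq)

lemma ss_pow_Suc: "ss_pow p (Suc k) = ss_mult p (ss_pow p k)"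
  by (simp add: ss_pow_def)

section \<open>Powers of scalar series and cancellation of sums of squares\<close>

context complex_vector_space
begin

lemma cmul_commute:
  "cmul smul p (cmul smul q f) = cmul smul q (cmul smul p (f :: 'i::finite mi \<Rightarrow> 'v))"
  by (metis cmul_assoc ss_mult_commute)

lemma cmul_pow_Suc: "cmul smul (ss_pow p (Suc k)) f = cmul smul p (cmul smul (ss_pow p k) (f :: 'i::finite mi \<Rightarrow> 'v))"
  by (simp add: ss_pow_Suc cmul_assoc)

lemma cmul_pow_add:
  "cmul smul (ss_pow p (j + k)) f = cmul smul (ss_pow p j) (cmul smul (ss_pow p k) (f :: 'i::finite mi \<Rightarrow> 'v))"
  by (induction j) (simp_all add: cmul_pow_Suc)

lemma cmul_ssq:
  "cmul smul (ssq S) f n = (\<Sum>i\<in>S. if 2 \<le> n i then f (n - mi_scale 2 (mi_delta i)) else 0)"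
  for f :: "'i::finite mi \<Rightarrow> 'v"
proof -
  have e: "(\<lambda>j. if j = i then 2 else 0) = mi_scale 2 (mi_delta i)" for i :: 'i
    by (auto simp: mi_scale_def)
  have "mi_scale 2 (mi_delta i) \<le> n \<longleftrightarrow> 2 \<le> n i" for i
    by (auto simp: le_fun_def mi_scale_def)
  then show ?thesis
    unfolding ssq_def cmul_left_sum by (simp add: cmul_smono e)
qed

text \<open>Fix one variable z^i with i in S. The coefficient of z^m (z^i)^2 in the product is f m
  plus coefficients of f whose total degree in the variables other than z^i is smaller by 2, so f
  vanishes by induction on that degree.\<close>

lemma cmul_ssq_inj0:
  fixes f :: "'i::finite mi \<Rightarrow> 'v"
  assumes "S \<noteq> {}" and z: "cmul smul (ssq S) f = 0"
  shows "f = 0"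
proof -
  obtain i where i: "i \<in> S" using assms by blast
  have "f m = 0" for m
  proof (induction "\<Sum>j\<in>-{i}. m j" arbitrary: m rule: less_induct)
    case less
    let ?n = "m + mi_scale 2 (mi_delta i)"
    have "(if 2 \<le> ?n j then f (?n - mi_scale 2 (mi_delta j)) else 0) = 0" if "j \<in> S - {i}" for j
    proof (cases "2 \<le> m j")
      case True
      have "(\<Sum>k\<in>-{i}. (?n - mi_scale 2 (mi_delta j)) k) < (\<Sum>k\<in>-{i}. m k)"
        using that True by (intro sum_strict_mono_ex1) (auto simp: mi_scale_def intro!: bexI[of _ j])
      then show ?thesis using less by simp
    next
      case False
      then show ?thesis using that by (simp add: mi_scale_def)
    qed
    then have "(\<Sum>j\<in>S - {i}. if 2 \<le> ?n j then f (?n - mi_scale 2 (mi_delta j)) else 0) = 0"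
      by (intro sum.neutral) blast
    moreover have "cmul smul (ssq S) f ?n = 0" using z by simp
    ultimately have "(if 2 \<le> ?n i then f (?n - mi_scale 2 (mi_delta i)) else 0) = 0"
      unfolding cmul_ssq by (simp add: sum.remove[OF _ i])
    then show ?case by (simp add: mi_scale_def)
  qed
  then show ?thesis by (simp add: fun_eq_iff)
qed

end

section \<open>Series in two sets of variables\<close>

lemma mi_join_simps [simp]: "mi_join e n (Inl i) = e i" "mi_join e n (Inr i) = n i"
  by (simp_all add: mi_join_def)

lemma mi_join_eta: "mi_join (\<lambda>i. m (Inl i)) (\<lambda>i. m (Inr i)) = m"
  by (rule ext) (auto simp: mi_join_def split: sum.split)

lemma mi_join_eq_iff [simp]: "mi_join e n = mi_join e' n' \<longleftrightarrow> e = e' \<and> n = n'"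
  by (metis mi_join_simps ext)

lemma mi_join_le_iff [simp]: "mi_join e n \<le> mi_join e' n' \<longleftrightarrow> e \<le> e' \<and> n \<le> n'"
proof -
  have "(\<forall>x. mi_join e n x \<le> mi_join e' n' x) \<longleftrightarrow> (\<forall>i. e i \<le> e' i) \<and> (\<forall>i. n i \<le> n' i)"
    by (metis mi_join_simps sumE)
  then show ?thesis by (simp add: le_fun_def)
qed

lemma mi_join_diff: "mi_join e n - mi_join e' n' = mi_join (e - e') (n - n')"
  by (rule ext) (auto simp: mi_join_def split: sum.split)

lemma mi_join_zero: "mi_join 0 0 = 0"
  by (rule ext) (auto simp: mi_join_def split: sum.split)

lemma ext_join: "(\<And>e n. f (mi_join e n) = g (mi_join e n)) \<Longrightarrow> f = g"
  by (metis mi_join_eta ext)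

lemma mi_le_joinD: "m \<le> mi_join e n \<Longrightarrow> (\<lambda>i. m (Inr i)) \<le> n" "m \<le> mi_join e n \<Longrightarrow> (\<lambda>i. m (Inl i)) \<le> e"
  by (metis mi_join_eta mi_join_le_iff)+

lemma const_zero_fun [simp]: "(\<lambda>x. 0) = 0"
  by (simp add: zero_fun_def)

text \<open>The coefficient of w^n, as a series in z.\<close>

definition slice :: "(('d + 'd) mi \<Rightarrow> 'a) \<Rightarrow> 'd mi \<Rightarrow> 'd mi \<Rightarrow> 'a" where
  "slice H n = (\<lambda>e. H (mi_join e n))"

lemma sum_mi_join:
  "(\<Sum>m\<in>{m. m \<le> mi_join e n}. f m)
   = (\<Sum>n'\<in>{n'. n' \<le> n}. \<Sum>e'\<in>{e'. e' \<le> e}. f (mi_join e' (n' :: 'd::finite mi)))"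
  unfolding sum.Sigma[OF finite_mi_le ballI[OF finite_mi_le]]
  by (rule sum.reindex_bij_witness[of _ "\<lambda>(n',e'). mi_join e' n'"
        "\<lambda>m. (\<lambda>i. m (Inr i), \<lambda>i. m (Inl i))"])
    (auto simp: mi_join_eta dest: mi_le_joinD)

lemma swp_join [simp]: "swp h (mi_join e n) = h (mi_join n e)"
proof -
  have "mi_join e n \<circ> case_sum Inr Inl = mi_join n e"
    by (rule ext) (auto simp: mi_join_def split: sum.split)
  then show ?thesis by (simp add: swp_def)
qed

lemma swp_swp [simp]: "swp (swp h) = h"
  by (rule ext_join) simp

lemma swp_zero [simp]: "swp (0 :: _ \<Rightarrow> 'a::zero) = 0"
  by (rule ext_join) simp

lemma swp_add: "swp (f + g) = swp f + swp (g :: _ \<Rightarrow> 'a::ab_group_add)"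
  by (rule ext_join) simp

text \<open>The embedding of series in z into series in (z,w); \<open>swp (xser p)\<close> serves as
  p(w).\<close>

definition xser :: "('d mi \<Rightarrow> complex) \<Rightarrow> ('d + 'd) mi \<Rightarrow> complex" where
  "xser p m = (if (\<lambda>i. m (Inr i)) = 0 then p (\<lambda>i. m (Inl i)) else 0)"

lemma xser_join: "xser p (mi_join e n) = (if n = 0 then p e else 0)"
  by (simp add: xser_def)

lemma slice_smono: "slice (smono (mi_join e n)) n' = (if n' = n then smono e else 0)"
  by (rule ext) (simp add: slice_def smono_def)

lemma xsq_eq: "xsq = xser (zsq :: 'd::finite mi \<Rightarrow> complex)"
proof (rule ext_join)
  fix e n :: "'d mi"
  have j: "(\<lambda>j. if j = Inl i then 2 else 0) = mi_join (\<lambda>j. if j = i then 2 else 0) 0" for i :: 'd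
    by (rule ext) (auto simp: mi_join_def split: sum.split)
  show "xsq (mi_join e n) = xser zsq (mi_join e n)"
    by (simp add: xsq_def zsq_def ssq_def xser_join sum.reindex j smono_def)
qed

lemma ysq_eq: "ysq = swp (xser (zsq :: 'd::finite mi \<Rightarrow> complex))"
proof (rule ext_join)
  fix e n :: "'d mi"
  have j: "(\<lambda>j. if j = Inr i then 2 else 0) = mi_join 0 (\<lambda>j. if j = i then 2 else 0)" for i :: 'd
    by (rule ext) (auto simp: mi_join_def split: sum.split)
  show "ysq (mi_join e n) = swp (xser zsq) (mi_join e n)"
    by (simp add: ysq_def zsq_def ssq_def xser_join sum.reindex j smono_def)
qed

lemma swp_xsq [simp]: "swp xsq = ysq" and swp_ysq [simp]: "swp ysq = xsq"
  by (simp_all add: xsq_eq ysq_eq)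

context complex_vector_space
begin

lemma cmul_join:
  "cmul smul c H (mi_join e n)
   = (\<Sum>n'\<in>{n'. n' \<le> n}. cmul smul (slice c n') (slice H (n - n')) (e :: 'd::finite mi))"
  by (simp add: cmul_eq sum_mi_join mi_join_diff slice_def)

lemma slice_cmul:
  "slice (cmul smul c H) n
   = (\<Sum>n'\<in>{n'. n' \<le> n}. cmul smul (slice c n') (slice H (n - n' :: 'd::finite mi)))"
  by (rule ext) (simp add: slice_def[of "cmul smul c H"] cmul_join sum_fun_apply)

lemma slice_cmul_xser: "slice (cmul smul (xser p) H) n = cmul smul p (slice H (n :: 'd::finite mi))"
proof
  fix e
  have s: "slice (xser p) n' = (if n' = 0 then p else 0)" for n'
    by (rule ext) (simp add: slice_def xser_join)
  have "cmul smul (slice (xser p) n') (slice H (n - n')) e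
    = (if n' = 0 then cmul smul p (slice H n) e else 0)" for n'
    unfolding s by (simp add: cmul_eq)
  then show "slice (cmul smul (xser p) H) n e = cmul smul p (slice H n) e"
    by (simp add: slice_cmul sum_fun_apply sum.delta)
qed

lemma slice_cmul_xsq_pow:
  "slice (cmul smul (ss_pow xsq k) H) n = cmul smul (ss_pow zsq k) (slice H (n :: 'd::finite mi))"
proof (induction k)
  case (Suc k)
  then show ?case by (simp add: cmul_pow_Suc xsq_eq slice_cmul_xser)
qed simp

lemma swp_cmul: "swp (cmul smul c H) = cmul smul (swp c) (swp (H :: ('d::finite + 'd) mi \<Rightarrow> 'v))"
proof (rule ext_join)
  fix e n :: "'d mi"
  have "cmul smul c H (mi_join n e)
    = (\<Sum>e'\<in>{e'. e' \<le> e}. \<Sum>n'\<in>{n'. n' \<le> n}. smul (c (mi_join n' e')) (H (mi_join (n - n') (e - e'))))"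
    by (simp add: cmul_eq sum_mi_join mi_join_diff)
  also have "\<dots> = (\<Sum>n'\<in>{n'. n' \<le> n}. \<Sum>e'\<in>{e'. e' \<le> e}. smul (c (mi_join n' e')) (H (mi_join (n - n') (e - e'))))"
    by (rule sum.swap)
  also have "\<dots> = cmul smul (swp c) (swp H) (mi_join e n)"
    by (simp add: cmul_eq sum_mi_join mi_join_diff)
  finally show "swp (cmul smul c H) (mi_join e n) = cmul smul (swp c) (swp H) (mi_join e n)"
    by simp
qed

lemma cmul_yser_join:
  "cmul smul (swp (xser p)) H (mi_join e n) = cmul smul p (\<lambda>k. H (mi_join e k)) (n :: 'd::finite mi)"
proof -
  have "cmul smul (swp (xser p)) H (mi_join e n) = swp (cmul smul (swp (xser p)) H) (mi_join n e)"
    by simp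
  also have "\<dots> = slice (cmul smul (xser p) (swp H)) e n"
    by (simp add: swp_cmul slice_def)
  finally show ?thesis by (simp add: slice_cmul_xser) (simp add: slice_def)
qed

lemma cmul_ysq_pow_join:
  "cmul smul (ss_pow ysq k) H (mi_join e n)
   = cmul smul (ss_pow zsq k) (\<lambda>m. H (mi_join e m)) (n :: 'd::finite mi)"
proof (induction k arbitrary: n)
  case (Suc k)
  then show ?case by (simp add: cmul_pow_Suc ysq_eq cmul_yser_join)
qed simp

end

lemma swp_smono_zero [simp]: "swp (smono 0) = smono (0 :: ('d + 'd) mi)"
  by (rule ext_join) (auto simp: smono_def simp flip: mi_join_zero)

lemma swp_ss_pow: "swp (ss_pow p k) = ss_pow (swp (p :: ('d::finite + 'd) mi \<Rightarrow> complex)) k"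
  by (induction k) (simp_all add: ss_pow_Suc ss_mult_eq_cmul cplx.swp_cmul)

lemma ss_pow_2: "ss_pow p 2 = ss_mult p (p :: 'i::finite mi \<Rightarrow> complex)"
proof -
  have "ss_mult p (smono 0) = p"
    unfolding ss_mult_commute[of p] by (simp add: ss_mult_eq_cmul)
  then show ?thesis by (simp add: numeral_2_eq_2 ss_pow_Suc)
qed

text \<open>Exchanging the variables only changes the sign of each z^a - w^a, and the signs
  disappear on squaring. Hence one locality factor serves both orders of a product.\<close>

lemma swp_xydiff_sq [simp]: "swp xydiff_sq = (xydiff_sq :: ('d::finite + 'd) mi \<Rightarrow> complex)"
proof (rule ext)
  fix m :: "('d + 'd) mi"
  define p :: "'d \<Rightarrow> ('d + 'd) mi \<Rightarrow> complex"
    where "p a = (\<lambda>m. smono (mi_delta (Inl a)) m - smono (mi_delta (Inr a)) m)" for a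
  have j: "mi_delta (Inl a) = mi_join (mi_delta a) 0" "mi_delta (Inr a) = mi_join 0 (mi_delta a)"
    for a :: 'd
    by (rule ext; auto simp: mi_join_def split: sum.split)+
  have "swp (p a) = - p a" for a
    by (rule ext_join) (auto simp: p_def j smono_def)
  moreover have "ss_mult (- p a) (- p a) = ss_mult (p a) (p a)" for a
    by (rule ext) (simp add: ss_mult_def)
  ultimately have "swp (ss_pow (p a) 2) = ss_pow (p a) 2" for a
    by (metis swp_ss_pow ss_pow_2)
  then have "ss_pow (p a) 2 (m \<circ> case_sum Inr Inl) = ss_pow (p a) 2 m" for a
    by (metis swp_def)
  then show "swp xydiff_sq m = xydiff_sq m"
    by (simp add: swp_def xydiff_sq_def flip: p_def)
qed

lemma slice_0_ss_mult:
  "slice (ss_mult p q) 0 = ss_mult (slice p 0) (slice q (0 :: 'd::finite mi))"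
  by (simp add: ss_mult_eq_cmul cplx.slice_cmul)

lemma slice_0_ss_pow: "slice (ss_pow p k) 0 = ss_pow (slice p (0 :: 'd::finite mi)) k"
proof (induction k)
  case 0
  show ?case by (simp add: slice_smono flip: mi_join_zero)
next
  case (Suc k)
  then show ?case by (simp add: ss_pow_Suc slice_0_ss_mult)
qed

text \<open>Setting w = 0 is what turns the locality factor into a power of z^2, which can then be
  cancelled.\<close>

lemma slice_0_xydiff_sq: "slice xydiff_sq 0 = (zsq :: 'd::finite mi \<Rightarrow> complex)"
proof (rule ext)
  fix e :: "'d mi"
  define p :: "'d \<Rightarrow> ('d + 'd) mi \<Rightarrow> complex"
    where "p a = (\<lambda>m. smono (mi_delta (Inl a)) m - smono (mi_delta (Inr a)) m)" for a
  have j: "mi_delta (Inl a) = mi_join (mi_delta a) 0" "mi_delta (Inr a) = mi_join 0 (mi_delta a)"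
    for a :: 'd
    by (rule ext; auto simp: mi_join_def split: sum.split)+
  have n: "mi_delta a \<noteq> 0" for a :: 'd
    by (metis mi_delta_apply zero_fun_apply zero_neq_one)
  have s: "slice (p a) 0 = smono (mi_delta a)" for a
    using n[of a] by (intro ext) (auto simp: p_def slice_def j smono_def)
  have m: "ss_mult (smono (mi_delta a)) (smono (mi_delta a)) = smono (\<lambda>j. if j = a then 2 else 0)"
    for a :: 'd
  proof
    fix k :: "'d mi"
    have "mi_delta a \<le> k \<and> k - mi_delta a = mi_delta a \<longleftrightarrow> k = (\<lambda>j. if j = a then 2 else 0)"
    proof
      assume "mi_delta a \<le> k \<and> k - mi_delta a = mi_delta a"
      then have "k = mi_delta a + mi_delta a" by (metis mi_add_diff(1))
      then show "k = (\<lambda>j. if j = a then 2 else 0)" by (simp add: fun_eq_iff)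
    qed (auto simp: le_fun_def)
    then show "ss_mult (smono (mi_delta a)) (smono (mi_delta a)) k = smono (\<lambda>j. if j = a then 2 else 0) k"
      by (simp add: ss_mult_eq_cmul cplx.cmul_smono) (auto simp: smono_def)
  qed
  have "slice (ss_pow (p a) 2) 0 = smono (\<lambda>j. if j = a then 2 else 0)" for a
    by (simp only: slice_0_ss_pow s) (simp only: ss_pow_2 m)
  then have "ss_pow (p a) 2 (mi_join e 0) = smono (\<lambda>j. if j = a then 2 else 0) e" for a
    by (metis slice_def)
  then show "slice xydiff_sq 0 e = zsq e"
    by (simp add: slice_def xydiff_sq_def zsq_def ssq_def flip: p_def)
qed

section \<open>Numerators in the localisation\<close>

context complex_vector_space
begin

lemma cmul_ssq_pow_inj:
  fixes f :: "'i::finite mi \<Rightarrow> 'v"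
  assumes "S \<noteq> {}" "cmul smul (ss_pow (ssq S) k) f = cmul smul (ss_pow (ssq S) k) g"
  shows "f = g"
proof -
  have "f - g = 0" if "cmul smul (ss_pow (ssq S) k) (f - g) = 0"
    using that
  proof (induction k)
    case (Suc k)
    then show ?case using cmul_ssq_inj0[OF assms(1)] by (simp only: cmul_pow_Suc)
  qed simp
  then show ?thesis using assms(2) by (simp add: cmul_diff)
qed

lemma cmul_zsq_pow_inj:
  "cmul smul (ss_pow zsq k) f = cmul smul (ss_pow zsq k) g \<Longrightarrow> f = (g :: 'd::finite mi \<Rightarrow> 'v)"
  unfolding zsq_def by (rule cmul_ssq_pow_inj[of UNIV]) auto

lemma cmul_ysq_pow_inj:
  "cmul smul (ss_pow ysq k) f = cmul smul (ss_pow ysq k) g \<Longrightarrow> f = (g :: ('d::finite + 'd) mi \<Rightarrow> 'v)"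
  unfolding ysq_def by (rule cmul_ssq_pow_inj[of "range Inr"]) auto

text \<open>The numerator of u over the denominator (z^2)^N. For N below \<open>fst u\<close> the
  truncated subtraction returns just \<open>snd u\<close>, so statements about \<open>nu\<close> are
  made for large N.\<close>

definition nu :: "('d::finite,'v) ls \<Rightarrow> nat \<Rightarrow> 'd mi \<Rightarrow> 'v" where
  "nu u N = cmul smul (ss_pow zsq (N - fst u)) (snd u)"

lemma nu_pair: "nu (K, f) N = cmul smul (ss_pow zsq (N - K)) f"
  by (simp add: nu_def)

lemma nu_shift: "fst u \<le> N \<Longrightarrow> nu u (N + j) = cmul smul (ss_pow zsq j) (nu u N)"
  by (simp add: nu_def flip: cmul_pow_add) (simp add: add.commute)

lemma ls_eq_iff_nu: 
  "ls_eq smul u v \<longleftrightarrow> (\<exists>k. nu u (fst u + fst v + k) = nu v (fst u + fst v + k))"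
  by (simp add: ls_eq_def nu_def add.commute add.left_commute)

text \<open>Raising N far enough reaches an exponent where the numerators are known to agree; the
  extra power of z^2 is then cancelled.\<close>

lemma ls_eqD:
  assumes "ls_eq smul u v" "fst u \<le> N" "fst v \<le> N"
  shows "nu u N = nu v N"
proof -
  obtain k where k: "nu u (fst u + fst v + k) = nu v (fst u + fst v + k)"
    using assms(1) by (auto simp: ls_eq_iff_nu)
  have "nu u (N + (fst u + fst v + k)) = nu v (N + (fst u + fst v + k))"
    using nu_shift[of u "fst u + fst v + k" N] nu_shift[of v "fst u + fst v + k" N] k
    by (simp add: add.commute)
  then show ?thesis
    using assms(2,3) by (simp add: nu_shift) (metis cmul_zsq_pow_inj)
qed

text \<open>This replaces equivalence of fractions by a filter statement, so that finitely many
  equivalences can be combined by \<open>eventually_elim\<close> as if they were equations.\<close>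

lemma eventually_ls_eq: "ls_eq smul u v \<longleftrightarrow> (\<forall>\<^sub>F N in sequentially. nu u N = nu v N)"
proof
  assume "ls_eq smul u v"
  then show "\<forall>\<^sub>F N in sequentially. nu u N = nu v N"
    by (intro eventually_sequentiallyI[of "max (fst u) (fst v)"]) (simp add: ls_eqD)
next
  assume "\<forall>\<^sub>F N in sequentially. nu u N = nu v N"
  then obtain M where "\<And>N. M \<le> N \<Longrightarrow> nu u N = nu v N"
    by (auto simp: eventually_sequentially)
  then show "ls_eq smul u v" unfolding ls_eq_iff_nu by (meson le_add2)
qed

lemma nu_add: "\<forall>\<^sub>F N in sequentially. nu (ls_add smul u v) N = nu u N + nu v N"
proof (rule eventually_sequentiallyI[of "fst u + fst v"])
  fix N assume N: "fst u + fst v \<le> N"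
  have e: "snd (ls_add smul u v) = cmul smul (ss_pow zsq (fst v)) (snd u) + cmul smul (ss_pow zsq (fst u)) (snd v)"
    by (simp add: ls_add_def plus_fun_def)
  have "N - (fst u + fst v) + fst v = N - fst u" "N - (fst u + fst v) + fst u = N - fst v"
    using N by auto
  then show "nu (ls_add smul u v) N = nu u N + nu v N"
    by (simp add: nu_def e cmul_add flip: cmul_pow_add) (simp add: ls_add_def)
qed

lemma nu_scale: "nu (ls_scale smul c u) N = (\<lambda>n. smul c (nu u N n))"
  by (simp add: nu_def ls_scale_def cmul_scale)

lemma nu_map: "Vector_Spaces.linear smul smul \<phi> \<Longrightarrow> nu (ls_map \<phi> u) N = (\<lambda>n. \<phi> (nu u N n))"
  by (simp add: nu_def ls_map_def cmul_map)

lemma nu_cmul: "nu (ls_cmul smul p u) N = cmul smul p (nu u N)"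
  by (simp add: nu_def ls_cmul_def cmul_commute)

lemma nu_sum:
  assumes "finite S"
  shows "\<forall>\<^sub>F N in sequentially. nu (ls_sum smul S \<phi>) N = (\<Sum>s\<in>S. nu (\<phi> s) N)"
proof -
  define Nm where "Nm = Max (insert 0 ((\<lambda>s. fst (\<phi> s)) ` S))"
  have le: "fst (\<phi> s) \<le> Nm" if "s \<in> S" for s
    unfolding Nm_def using assms that by (intro Max_ge) auto
  have e: "ls_sum smul S \<phi> = (Nm, \<Sum>s\<in>S. cmul smul (ss_pow zsq (Nm - fst (\<phi> s))) (snd (\<phi> s)))"
    unfolding ls_sum_def Let_def Nm_def[symmetric] by (auto simp: sum_fun_apply fun_eq_iff)
  show ?thesis
  proof (rule eventually_sequentiallyI[of Nm])
    fix N assume N: "Nm \<le> N"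
    have "N - Nm + (Nm - fst (\<phi> s)) = N - fst (\<phi> s)" if "s \<in> S" for s
      using le[OF that] N by simp
    then show "nu (ls_sum smul S \<phi>) N = (\<Sum>s\<in>S. nu (\<phi> s) N)"
      unfolding e by (simp add: nu_def cmul_sum flip: cmul_pow_add)
  qed
qed

lemma ls_eq_refl [simp]: "ls_eq smul u u"
  by (simp add: eventually_ls_eq)

lemma ls_eq_sym: "ls_eq smul u v \<Longrightarrow> ls_eq smul v u"
  unfolding eventually_ls_eq by (auto elim: eventually_mono)

lemma ls_eq_trans:
  assumes "ls_eq smul u v" "ls_eq smul v w"
  shows "ls_eq smul u w"
  using assms unfolding eventually_ls_eq by eventually_elim simp

lemma ls_eq_numerator_unique:
  "ls_eq smul (0, f) (0, g) \<Longrightarrow> f = g"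
  using ls_eqD[of "(0, f)" "(0, g)" 0] by (simp add: nu_def)

end

section \<open>Families of numerators\<close>

text \<open>An element of the iterated localisation \<open>(V[[z]]_{z^2})[[w]]_{w^2}\<close> is handled through the family
  \<open>G M N\<close> of its numerators with respect to \<open>(w^2)^M (z^2)^N\<close>. The admissible \<open>N\<close> depends on the
  exponent of \<open>w\<close>, which explains the order of the quantifiers in \<open>weq\<close>.\<close>

type_synonym ('d,'v) fam = "nat \<Rightarrow> nat \<Rightarrow> ('d + 'd) mi \<Rightarrow> 'v"

definition sleq :: "(nat \<Rightarrow> ('d + 'd) mi \<Rightarrow> 'v) \<Rightarrow> (nat \<Rightarrow> ('d + 'd) mi \<Rightarrow> 'v) \<Rightarrow> bool" where
  "sleq H H' \<longleftrightarrow> (\<forall>n. \<forall>\<^sub>F N in sequentially. slice (H N) n = slice (H' N) n)"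

definition weq :: "('d,'v) fam \<Rightarrow> ('d,'v) fam \<Rightarrow> bool" where
  "weq G G' \<longleftrightarrow> (\<forall>\<^sub>F M in sequentially. sleq (G M) (G' M))"

lemma slice_add: "slice (f + g) n = slice f n + slice (g :: _ \<Rightarrow> 'a::ab_group_add) n"
  by (rule ext) (simp add: slice_def)

lemma slice_diff: "slice (f - g) n = slice f n - slice (g :: _ \<Rightarrow> 'a::ab_group_add) n"
  by (rule ext) (simp add: slice_def)

lemma slice_zero [simp]: "slice (0 :: _ \<Rightarrow> 'a::ab_group_add) n = 0"
  by (rule ext) (simp add: slice_def)

lemma slice_sum: "slice (\<Sum>s\<in>S. f s) n = (\<Sum>s\<in>S. slice (f s :: _ \<Rightarrow> 'a::ab_group_add) n)"
  by (rule ext) (simp add: slice_def sum_fun_apply)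

lemma slice_ext: "(\<And>n. slice f n = slice g n) \<Longrightarrow> f = g"
  by (rule ext_join) (metis slice_def)

lemma sleq_refl [simp]: "sleq H H"
  by (simp add: sleq_def)

lemma sleq_sym: "sleq H H' \<Longrightarrow> sleq H' H"
  by (simp add: sleq_def eq_commute)

lemma sleq_trans:
  assumes "sleq H H'" "sleq H' H''" shows "sleq H H''"
  unfolding sleq_def
proof
  fix n
  have "\<forall>\<^sub>F N in sequentially. slice (H N) n = slice (H' N) n"
    "\<forall>\<^sub>F N in sequentially. slice (H' N) n = slice (H'' N) n"
    using assms by (auto simp: sleq_def)
  then show "\<forall>\<^sub>F N in sequentially. slice (H N) n = slice (H'' N) n"
    by eventually_elim simp
qed

lemma weq_refl [simp]: "weq G G"
  by (simp add: weq_def)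

lemma weqI: "(\<And>M. sleq (G M) (G' M)) \<Longrightarrow> weq G G'"
  by (simp add: weq_def)

lemma weq_sym: "weq G G' \<Longrightarrow> weq G' G"
  unfolding weq_def by (auto elim: eventually_mono simp: sleq_sym)

lemma weq_trans [trans]:
  assumes "weq G G'" "weq G' G''" shows "weq G G''"
  using assms unfolding weq_def by eventually_elim (rule sleq_trans)

lemma weq_add:
  fixes G1 :: "('d,'v::ab_group_add) fam"
  assumes "weq G1 G1'" "weq G2 G2'"
  shows "weq (G1 + G2) (G1' + G2')"
  using assms unfolding weq_def
proof eventually_elim
  case (elim M)
  show ?case unfolding sleq_def
  proof
    fix n
    have "\<forall>\<^sub>F N in sequentially. slice (G1 M N) n = slice (G1' M N) n"
      "\<forall>\<^sub>F N in sequentially. slice (G2 M N) n = slice (G2' M N) n"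
      using elim by (auto simp: sleq_def)
    then show "\<forall>\<^sub>F N in sequentially. slice ((G1 + G2) M N) n = slice ((G1' + G2') M N) n"
      by eventually_elim (simp add: slice_add)
  qed
qed

lemma weq_diff:
  fixes G1 :: "('d,'v::ab_group_add) fam"
  assumes "weq G1 G1'" "weq G2 G2'"
  shows "weq (G1 - G2) (G1' - G2')"
  using assms unfolding weq_def
proof eventually_elim
  case (elim M)
  show ?case unfolding sleq_def
  proof
    fix n
    have "\<forall>\<^sub>F N in sequentially. slice (G1 M N) n = slice (G1' M N) n"
      "\<forall>\<^sub>F N in sequentially. slice (G2 M N) n = slice (G2' M N) n"
      using elim by (auto simp: sleq_def)
    then show "\<forall>\<^sub>F N in sequentially. slice ((G1 - G2) M N) n = slice ((G1' - G2') M N) n"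
      by eventually_elim (simp add: slice_diff)
  qed
qed

lemma weq_sum:
  fixes G :: "'s \<Rightarrow> ('d,'v::ab_group_add) fam"
  assumes "\<And>s. s \<in> S \<Longrightarrow> weq (G s) (G' s)"
  shows "weq (\<Sum>s\<in>S. G s) (\<Sum>s\<in>S. G' s)"
  using assms by (induction S rule: infinite_finite_induct) (simp_all add: weq_add)

context complex_vector_space
begin

definition fmul :: "(('d::finite + 'd) mi \<Rightarrow> complex) \<Rightarrow> ('d,'v) fam \<Rightarrow> ('d,'v) fam" where
  "fmul p G = (\<lambda>M N. cmul smul p (G M N))"

definition fscale :: "complex \<Rightarrow> ('d,'v) fam \<Rightarrow> ('d,'v) fam" where
  "fscale c G = (\<lambda>M N m. smul c (G M N m))"

lemma fmul_add: "fmul p (G + G') = fmul p G + fmul p G'"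
  by (intro ext) (simp add: fmul_def cmul_add)

lemma fmul_zero [simp]: "fmul p 0 = 0"
  by (intro ext) (simp add: fmul_def)

lemma fmul_commute: "fmul p (fmul q G) = fmul q (fmul p G)"
  by (intro ext) (simp add: fmul_def cmul_commute)

lemma fmul_scale: "fmul p (fscale c G) = fscale c (fmul p G)"
  by (simp add: fmul_def fscale_def cmul_scale)

lemma fmul_pow_add: "fmul (ss_pow p (j + k)) G = fmul (ss_pow p j) (fmul (ss_pow p k) G)"
  by (simp add: fmul_def cmul_pow_add)

text \<open>The coefficient of w^n in the product involves only the finitely many slices below n, so
  their separate thresholds for N have a common bound.\<close>

lemma sleq_cmul:
  fixes p :: "('d::finite + 'd) mi \<Rightarrow> complex"
  assumes "sleq H H'"
  shows "sleq (\<lambda>N. cmul smul p (H N)) (\<lambda>N. cmul smul p (H' N))"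
  unfolding sleq_def
proof
  fix n :: "'d mi"
  have "\<forall>\<^sub>F N in sequentially. \<forall>m\<in>{m. m \<le> n}. slice (H N) (n - m) = slice (H' N) (n - m)"
    using assms by (intro eventually_ball_finite) (auto simp: sleq_def)
  then show "\<forall>\<^sub>F N in sequentially. slice (cmul smul p (H N)) n = slice (cmul smul p (H' N)) n"
    by eventually_elim (simp add: slice_cmul)
qed

lemma weq_fmul: "weq G G' \<Longrightarrow> weq (fmul p G) (fmul p G')"
  unfolding weq_def fmul_def by (erule eventually_mono) (rule sleq_cmul)

lemma weq_fscale:
  assumes "weq G G'" shows "weq (fscale c G) (fscale c G')"
proof -
  have "sleq (fscale c G M) (fscale c G' M)" if "sleq (G M) (G' M)" for M
    unfolding sleq_def
  proof
    fix n
    show "\<forall>\<^sub>F N in sequentially. slice (fscale c G M N) n = slice (fscale c G' M N) n"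
      using that unfolding sleq_def
      by (rule eventually_mono[OF spec[of _ n]]) (auto simp: fscale_def slice_def fun_eq_iff)
  qed
  then show ?thesis using assms unfolding weq_def by (auto elim: eventually_mono)
qed

text \<open>The family of (z^2 w^2)^(-K) h(z,w), a genuine element of V[[z,w]]_{z^2 w^2}: here the
  bound on N is K for every power of w.\<close>

definition rep :: "nat \<Rightarrow> (('d::finite + 'd) mi \<Rightarrow> 'v) \<Rightarrow> ('d,'v) fam" where
  "rep K h = (\<lambda>M N. cmul smul (ss_pow xsq (N - K)) (cmul smul (ss_pow ysq (M - K)) h))"

lemma rep_add: "rep K (h + h') = rep K h + rep K h'"
  by (intro ext) (simp add: rep_def cmul_add)

lemma rep_zero [simp]: "rep K 0 = 0"
  by (intro ext) (simp add: rep_def)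

lemma rep_fmul: "fmul p (rep K h) = rep K (cmul smul p h)"
  by (simp add: rep_def fmul_def cmul_commute)

lemma rep_fscale: "fscale c (rep K h) = rep K (\<lambda>m. smul c (h m))"
  by (simp add: rep_def fscale_def cmul_scale)

lemma swp_scale: "swp (\<lambda>m. smul c (h m)) = (\<lambda>m. smul c (swp h m))"
  by (simp add: swp_def)

lemma cmul_xysq_pow:
  "cmul smul (ss_pow xysq j) h
   = cmul smul (ss_pow xsq j) (cmul smul (ss_pow ysq j) (h :: ('d::finite + 'd) mi \<Rightarrow> 'v))"
proof (induction j)
  case (Suc j)
  then show ?case
    by (simp add: cmul_pow_Suc xysq_def cmul_assoc cmul_commute)
qed simp

text \<open>The fraction is expanded by (z^2 w^2)^j. The bound K + j on M and N keeps the truncated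
  differences of exponents exact.\<close>

lemma rep_shift: "weq (rep K h) (rep (K + j) (cmul smul (ss_pow xysq j) h))"
  unfolding weq_def
proof (rule eventually_sequentiallyI[of "K + j"])
  fix M assume M: "K + j \<le> M"
  have "rep K h M N = rep (K + j) (cmul smul (ss_pow xysq j) h) M N" if N: "K + j \<le> N" for N
  proof -
    have e: "N - K = (N - (K + j)) + j" "M - K = (M - (K + j)) + j"
      using M N by auto
    show ?thesis
      unfolding rep_def cmul_xysq_pow e cmul_pow_add by (simp add: cmul_commute)
  qed
  then show "sleq (rep K h M) (rep (K + j) (cmul smul (ss_pow xysq j) h) M)"
    unfolding sleq_def by (intro allI eventually_sequentiallyI[of "K + j"]) simp
qed

text \<open>V[[z,w]]_{z^2 w^2} embeds into the iterated localisation: a power of z^2 is cancelled on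
  each slice separately, then a power of w^2 on the whole series.\<close>

lemma rep_eq_0D:
  assumes "weq (rep K h) 0" shows "h = 0"
proof -
  obtain M where M: "sleq (rep K h M) 0"
    using assms unfolding weq_def
    by (metis (mono_tags, lifting) eventually_sequentially order_refl zero_fun_apply)
  have "slice (cmul smul (ss_pow ysq (M - K)) h) n = slice 0 n" for n
  proof -
    obtain N where "slice (rep K h M N) n = slice 0 n"
      using M unfolding sleq_def by (metis (mono_tags, lifting) eventually_sequentially order_refl zero_fun_apply)
    then have "cmul smul (ss_pow zsq (N - K)) (slice (cmul smul (ss_pow ysq (M - K)) h) n)
      = cmul smul (ss_pow zsq (N - K)) 0"
      by (simp add: rep_def slice_cmul_xsq_pow)
    then show ?thesis using cmul_zsq_pow_inj by fastforce
  qed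
  then have "cmul smul (ss_pow ysq (M - K)) h = cmul smul (ss_pow ysq (M - K)) 0"
    using slice_ext by (metis cmul_zero)
  then show ?thesis by (rule cmul_ysq_pow_inj)
qed

text \<open>The numerators of all coefficients F n, taken with the same N, are assembled into one
  series. For fixed N this is meaningful only on the slices whose denominator divides (z^2)^N, which
  is why comparisons are made slice by slice.\<close>

definition lift :: "('d mi \<Rightarrow> ('d::finite,'v) ls) \<Rightarrow> nat \<Rightarrow> ('d + 'd) mi \<Rightarrow> 'v" where
  "lift F N = (\<lambda>m. nu (F (\<lambda>i. m (Inr i))) N (\<lambda>i. m (Inl i)))"

definition wnum :: "('d::finite,'v) wls \<Rightarrow> ('d,'v) fam" where
  "wnum W = (\<lambda>M N. cmul smul (ss_pow ysq (M - fst W)) (lift (snd W) N))"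

lemma slice_lift: "slice (lift F N) n = nu (F n) N"
  by (rule ext) (simp add: slice_def lift_def)

lemma nu_wcoef:
  "\<forall>\<^sub>F N in sequentially. nu (wcoef smul c F n) N = slice (cmul smul c (lift F N)) n"
  using nu_sum[of "{e'. e' \<le> n}" "\<lambda>e'. ls_cmul smul (\<lambda>e. c (mi_join e e')) (F (mi_sub n e'))", OF finite_mi_le]
  unfolding wcoef_def
  by eventually_elim (simp add: slice_cmul slice_lift nu_cmul mi_sub_eq, simp add: slice_def)

text \<open>A witness k in \<open>lands\<close> amounts to comparing numerators over (w^2)^M for M =
  \<open>fst W + K + k\<close>. Agreement at one such M passes to all larger ones on multiplication
  by w^2, so the existential over k becomes "for all large M".\<close>

lemma lands_iff:
  "lands smul L W K h \<longleftrightarrow> weq (fmul (ss_pow xydiff_sq L) (wnum W)) (rep K h)"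
proof -
  define p where "p = ss_pow (xydiff_sq :: ('a + 'a) mi \<Rightarrow> complex) L"
  define E where "E M \<longleftrightarrow> sleq (fmul p (wnum W) M) (rep K h M)" for M
  have step: "(\<forall>n. ls_eq smul (wcoef smul (ss_mult p (ss_pow ysq (K + k))) (snd W) n)
                (K, \<lambda>e. cmul smul (ss_pow ysq (fst W + k)) h (mi_join e n))) \<longleftrightarrow> E (fst W + K + k)" for k
  proof -
    have "ls_eq smul (wcoef smul (ss_mult p (ss_pow ysq (K + k))) (snd W) n)
                (K, \<lambda>e. cmul smul (ss_pow ysq (fst W + k)) h (mi_join e n))
      \<longleftrightarrow> (\<forall>\<^sub>F N in sequentially. slice (fmul p (wnum W) (fst W + K + k) N) n = slice (rep K h (fst W + K + k) N) n)"
      (is "_ \<longleftrightarrow> eventually ?Q _") for n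
    proof -
      have "\<forall>\<^sub>F N in sequentially. (nu (wcoef smul (ss_mult p (ss_pow ysq (K + k))) (snd W) n) N
          = nu (K, \<lambda>e. cmul smul (ss_pow ysq (fst W + k)) h (mi_join e n)) N) = ?Q N"
        using nu_wcoef[of "ss_mult p (ss_pow ysq (K + k))" "snd W" n]
      proof eventually_elim
        case (elim N)
        have "nu (K, \<lambda>e. cmul smul (ss_pow ysq (fst W + k)) h (mi_join e n)) N
          = slice (rep K h (fst W + K + k) N) n"
          by (simp add: nu_pair rep_def slice_cmul_xsq_pow add.assoc)
            (simp add: slice_def add.left_commute)
        then show ?case using elim by (simp add: cmul_assoc fmul_def wnum_def add.assoc)
      qed
      then show ?thesis unfolding eventually_ls_eq by (rule eventually_cong)
    qed
    then show ?thesis by (simp add: E_def sleq_def)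
  qed
  have E_shift: "E (M + j)" if "E M" "fst W + K \<le> M" for M j
  proof -
    have e: "M + j - fst W = j + (M - fst W)" "M + j - K = j + (M - K)" using that by auto
    have "fmul p (wnum W) (M + j) = (\<lambda>N. cmul smul (ss_pow ysq j) (fmul p (wnum W) M N))"
      by (rule ext) (simp add: fmul_def wnum_def e cmul_pow_add cmul_commute)
    moreover have "rep K h (M + j) = (\<lambda>N. cmul smul (ss_pow ysq j) (rep K h M N))"
      by (rule ext) (simp add: rep_def e cmul_pow_add cmul_commute)
    ultimately show ?thesis
      using that(1) unfolding E_def by (simp add: sleq_cmul)
  qed
  have "lands smul L W K h \<longleftrightarrow> (\<exists>k. E (fst W + K + k))"
    by (simp add: lands_def step flip: p_def)
  also have "\<dots> \<longleftrightarrow> (\<forall>\<^sub>F M in sequentially. E M)"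
  proof
    assume "\<exists>k. E (fst W + K + k)"
    then obtain k where k: "E (fst W + K + k)" ..
    show "\<forall>\<^sub>F M in sequentially. E M"
    proof (rule eventually_sequentiallyI[of "fst W + K + k"])
      fix M assume "fst W + K + k \<le> M"
      then show "E M" using E_shift[OF k, of "M - (fst W + K + k)"] by simp
    qed
  next
    assume "\<forall>\<^sub>F M in sequentially. E M"
    then obtain M0 where "\<And>M. M0 \<le> M \<Longrightarrow> E M" by (auto simp: eventually_sequentially)
    then show "\<exists>k. E (fst W + K + k)" by (meson le_add2)
  qed
  finally show ?thesis by (simp add: weq_def E_def p_def)
qed

section \<open>Composition of fields\<close>

text \<open>Linearity up to equivalence of fractions: the representatives chosen for different
  vectors may have unrelated denominators.\<close>

definition ls_linear :: "('v \<Rightarrow> ('d::finite,'v) ls) \<Rightarrow> bool" where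
  "ls_linear A \<longleftrightarrow> (\<forall>v w. ls_eq smul (A (v + w)) (ls_add smul (A v) (A w)))
     \<and> (\<forall>c v. ls_eq smul (A (smul c v)) (ls_scale smul c (A v)))"

lemma ls_linear_iff:
  "ls_linear A \<longleftrightarrow> (\<forall>v w. \<forall>\<^sub>F N in sequentially. nu (A (v + w)) N = nu (A v) N + nu (A w) N)
     \<and> (\<forall>c v. \<forall>\<^sub>F N in sequentially. nu (A (smul c v)) N = (\<lambda>n. smul c (nu (A v) N n)))"
proof -
  have "(\<forall>\<^sub>F N in sequentially. nu x N = nu (ls_add smul u v) N)
    \<longleftrightarrow> (\<forall>\<^sub>F N in sequentially. nu x N = nu u N + nu v N)" for x u v :: "('a,'v) ls"
    by (rule eventually_cong) (use nu_add[of u v] in \<open>auto elim: eventually_mono\<close>)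
  then show ?thesis by (simp add: ls_linear_def eventually_ls_eq nu_scale)
qed

lemma ls_linear_add:
  "ls_linear A \<Longrightarrow> \<forall>\<^sub>F N in sequentially. nu (A (v + w)) N = nu (A v) N + nu (A w) N"
  by (simp add: ls_linear_iff)

lemma ls_linear_scale:
  "ls_linear A \<Longrightarrow> \<forall>\<^sub>F N in sequentially. nu (A (smul c v)) N = (\<lambda>n. smul c (nu (A v) N n))"
  by (simp add: ls_linear_iff)

lemma ls_linear_0:
  assumes "ls_linear A" shows "\<forall>\<^sub>F N in sequentially. nu (A 0) N = 0"
  using ls_linear_scale[OF assms, of 0 0] by simp

lemma ls_linear_sum:
  assumes "ls_linear A" "finite S"
  shows "\<forall>\<^sub>F N in sequentially.
    nu (A (\<Sum>s\<in>S. smul (c s) (v s))) N = (\<lambda>n. \<Sum>s\<in>S. smul (c s) (nu (A (v s)) N n))"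
  using assms(2)
proof induction
  case empty
  then show ?case using ls_linear_0[OF assms(1)] by simp
next
  case (insert x S)
  show ?case
    using insert.IH ls_linear_scale[OF assms(1), of "c x" "v x"]
      ls_linear_add[OF assms(1), of "smul (c x) (v x)" "\<Sum>s\<in>S. smul (c s) (v s)"]
    by eventually_elim (use insert in \<open>simp add: fun_eq_iff\<close>)
qed

text \<open>The numerators of A(z) u(w). Forming the numerator of u before applying A makes the
  family depend on u only up to \<open>ls_eq\<close>, whereas \<open>prod2\<close> applies A to the
  coefficients of a chosen representative.\<close>

definition fcomp :: "('v \<Rightarrow> ('d::finite,'v) ls) \<Rightarrow> ('d,'v) ls \<Rightarrow> ('d,'v) fam" where
  "fcomp A u = (\<lambda>M. lift (\<lambda>n. A (nu u M n)))"

lemma slice_fcomp: "slice (fcomp A u M N) n = nu (A (nu u M n)) N"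
  by (simp add: fcomp_def slice_lift)

lemma ls_linear_cmul:
  assumes "ls_linear A"
  shows "\<forall>\<^sub>F N in sequentially. 
    nu (A (cmul smul p f n)) N = (\<lambda>e. cmul smul p (\<lambda>m. nu (A (f m)) N e) (n :: 'i::finite mi))"
  using ls_linear_sum[OF assms finite_mi_le, of p "\<lambda>m. f (n - m)" n] by (simp add: cmul_eq)

text \<open>The two sides differ in whether the power of w^2 is multiplied in after or before A is
  applied. Linearity of A exchanges the two, for each power of w with its own bound on N.\<close>

lemma wnum_prod2:
  assumes "ls_linear A" shows "weq (wnum (prod2 A B c)) (fcomp A (B c))"
proof (rule weqI)
  fix M
  show "sleq (wnum (prod2 A B c) M) (fcomp A (B c) M)" unfolding sleq_def
  proof
    fix n
    show "\<forall>\<^sub>F N in sequentially. slice (wnum (prod2 A B c) M N) n = slice (fcomp A (B c) M N) n"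
      using ls_linear_cmul[OF assms, of "ss_pow zsq (M - fst (B c))" "snd (B c)" n]
    proof eventually_elim
      case (elim N)
      have "slice (wnum (prod2 A B c) M N) n e = slice (fcomp A (B c) M N) n e" for e
        unfolding slice_fcomp
        by (simp add: wnum_def slice_def prod2_def cmul_ysq_pow_join nu_def[of "B c"] elim)
          (simp add: lift_def)
      then show ?case by blast
    qed
  qed
qed

lemma fcomp_cong_left:
  assumes "\<And>v. ls_eq smul (A v) (A' v)" shows "weq (fcomp A u) (fcomp A' u)"
  using assms by (intro weqI) (simp add: sleq_def slice_fcomp eventually_ls_eq)

lemma fcomp_cong_right:
  assumes "ls_eq smul u u'" shows "weq (fcomp A u) (fcomp A u')"
  using assms unfolding eventually_ls_eq weq_def
  by (rule eventually_mono) (simp add: fcomp_def)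

lemma fcomp_add_left: "weq (fcomp (\<lambda>v. ls_add smul (A v) (B v)) u) (fcomp A u + fcomp B u)"
  by (intro weqI) (simp add: sleq_def slice_add slice_fcomp nu_add)

lemma fcomp_sum_cmul_left:
  assumes "finite S"
  shows "weq (fcomp (\<lambda>v. ls_sum smul S (\<lambda>s. ls_cmul smul (p s) (A s v))) u)
     (\<Sum>s\<in>S. fmul (xser (p s)) (fcomp (A s) u))"
proof (intro weqI)
  fix M
  have "\<forall>\<^sub>F N in sequentially. nu (ls_sum smul S (\<lambda>s. ls_cmul smul (p s) (A s (nu u M n)))) N 
     = (\<Sum>s\<in>S. cmul smul (p s) (nu (A s (nu u M n)) N))" for n
    using nu_sum[OF assms, of "\<lambda>s. ls_cmul smul (p s) (A s (nu u M n))"] by (simp add: nu_cmul)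
  then show "sleq (fcomp (\<lambda>v. ls_sum smul S (\<lambda>s. ls_cmul smul (p s) (A s v))) u M)
     ((\<Sum>s\<in>S. fmul (xser (p s)) (fcomp (A s) u)) M)"
    by (simp add: sleq_def slice_fcomp sum_fun_apply slice_sum fmul_def slice_cmul_xser)
qed

lemma fcomp_add_right:
  assumes "ls_linear A"
  shows "weq (fcomp A (ls_add smul u v)) (fcomp A u + fcomp A v)"
  unfolding weq_def using nu_add[of u v]
proof eventually_elim
  case (elim M)
  show ?case using ls_linear_add[OF assms]
    by (simp add: sleq_def slice_add slice_fcomp elim)
qed

text \<open>The factor p belongs to the inner argument, whose variable is w; hence the
  \<open>swp\<close>, in contrast to \<open>fcomp_sum_cmul_left\<close>.\<close>

lemma fcomp_cmul_right:
  assumes "ls_linear A"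
  shows "weq (fcomp A (ls_cmul smul p u)) (fmul (swp (xser p)) (fcomp A u))"
proof (intro weqI)
  fix M
  have e: "slice (fmul (swp (xser p)) (fcomp A u) M N) n
    = (\<lambda>e. cmul smul p (\<lambda>m. nu (A (nu u M m)) N e) n)" for N n
    by (rule ext) (simp add: fmul_def slice_def cmul_yser_join flip: slice_fcomp)
  then show "sleq (fcomp A (ls_cmul smul p u) M) (fmul (swp (xser p)) (fcomp A u) M)"
    unfolding sleq_def slice_fcomp nu_cmul e using ls_linear_cmul[OF assms] by blast
qed

lemma fcomp_sum_right:
  assumes "ls_linear A" "finite S"
  shows "weq (fcomp A (ls_sum smul S u)) (\<Sum>s\<in>S. fcomp A (u s))"
  unfolding weq_def using nu_sum[OF assms(2), of u]
proof eventually_elim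
  case (elim M)
  have "\<forall>\<^sub>F N in sequentially. nu (A (\<Sum>s\<in>S. nu (u s) M n)) N = (\<Sum>s\<in>S. nu (A (nu (u s) M n)) N)" for n
    using ls_linear_sum[OF assms, of "\<lambda>_. 1" "\<lambda>s. nu (u s) M n"]
    by eventually_elim (simp add: sum_fun_apply fun_eq_iff)
  then show ?case
    by (simp add: sleq_def slice_sum slice_fcomp elim sum_fun_apply)
qed

lemma wnum_wadd: "weq (wnum (wadd smul W1 W2)) (wnum W1 + wnum W2)"
  unfolding weq_def
proof (rule eventually_sequentiallyI[of "fst W1 + fst W2"])
  fix M assume M: "fst W1 + fst W2 \<le> M"
  let ?F = "\<lambda>N. cmul smul (ss_pow ysq (fst W2)) (lift (snd W1) N) + cmul smul (ss_pow ysq (fst W1)) (lift (snd W2) N)"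
  have "sleq (lift (snd (wadd smul W1 W2))) ?F"
    unfolding sleq_def slice_lift
  proof
    fix n
    show "\<forall>\<^sub>F N in sequentially. nu (snd (wadd smul W1 W2) n) N = slice (?F N) n"
      using nu_wcoef[of "ss_pow ysq (fst W2)" "snd W1" n] nu_wcoef[of "ss_pow ysq (fst W1)" "snd W2" n]
        nu_add[of "wcoef smul (ss_pow ysq (fst W2)) (snd W1) n" "wcoef smul (ss_pow ysq (fst W1)) (snd W2) n"]
      by eventually_elim (simp add: wadd_def slice_add)
  qed
  then have s: "sleq (\<lambda>N. cmul smul (ss_pow ysq (M - (fst W1 + fst W2))) (lift (snd (wadd smul W1 W2)) N))
     (\<lambda>N. cmul smul (ss_pow ysq (M - (fst W1 + fst W2))) (?F N))"
    by (rule sleq_cmul)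
  have m: "M - (fst W1 + fst W2) + fst W2 = M - fst W1" "M - (fst W1 + fst W2) + fst W1 = M - fst W2"
    using M by auto
  have "(\<lambda>N. cmul smul (ss_pow ysq (M - (fst W1 + fst W2))) (?F N)) = (wnum W1 + wnum W2) M"
    by (rule ext) (simp add: cmul_add wnum_def m flip: cmul_pow_add)
  moreover have "(\<lambda>N. cmul smul (ss_pow ysq (M - (fst W1 + fst W2))) (lift (snd (wadd smul W1 W2)) N))
     = wnum (wadd smul W1 W2) M"
    by (simp add: wnum_def wadd_def)
  ultimately show "sleq (wnum (wadd smul W1 W2) M) ((wnum W1 + wnum W2) M)"
    using s by (simp only:)
qed

section \<open>Locality of families\<close>

text \<open>G and G' are the two orders of a product. The outer field always occupies the first set
  of variables, so in G' the roles of z and w are exchanged and the common series appears there as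
  \<open>swp h\<close>.\<close>

definition loc2 :: "nat \<Rightarrow> ('d::finite,'v) fam \<Rightarrow> ('d,'v) fam \<Rightarrow> bool" where
  "loc2 L G G' \<longleftrightarrow> (\<exists>K h. weq (fmul (ss_pow xydiff_sq L) G) (rep K h)
     \<and> weq (fmul (ss_pow xydiff_sq L) G') (rep K (swp h)))"

text \<open>The parameter c is the vector acted upon: the exponent L must be uniform in c, while the
  denominator and h may depend on it.\<close>

definition locfam :: "('c \<Rightarrow> ('d::finite,'v) fam) \<Rightarrow> ('c \<Rightarrow> ('d,'v) fam) \<Rightarrow> bool" where
  "locfam G G' \<longleftrightarrow> (\<exists>L. \<forall>c. loc2 L (G c) (G' c))"

lemma loc2_cong: "loc2 L G G' \<Longrightarrow> weq G H \<Longrightarrow> weq G' H' \<Longrightarrow> loc2 L H H'"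
  unfolding loc2_def by (meson weq_fmul weq_sym weq_trans)

lemma loc2_zero [simp]: "loc2 L 0 0"
  unfolding loc2_def by (rule exI[of _ 0], rule exI[of _ 0]) simp

lemma swp_cmul_xysq_pow:
  "swp (cmul smul (ss_pow xysq j) h) = cmul smul (ss_pow xysq j) (swp (h :: ('d::finite + 'd) mi \<Rightarrow> 'v))"
proof -
  have "swp (cmul smul (ss_pow xysq j) h) = cmul smul (ss_pow ysq j) (cmul smul (ss_pow xsq j) (swp h))"
    by (simp add: cmul_xysq_pow swp_cmul swp_ss_pow)
  then show ?thesis by (simp add: cmul_xysq_pow cmul_commute)
qed

lemma loc2_add:
  assumes "loc2 L G1 G1'" "loc2 L G2 G2'"
  shows "loc2 L (G1 + G2) (G1' + G2')"
proof -
  let ?p = "ss_pow xydiff_sq L"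
  obtain K1 h1 where 1: "weq (fmul ?p G1) (rep K1 h1)" "weq (fmul ?p G1') (rep K1 (swp h1))"
    using assms(1) by (auto simp: loc2_def)
  obtain K2 h2 where 2: "weq (fmul ?p G2) (rep K2 h2)" "weq (fmul ?p G2') (rep K2 (swp h2))"
    using assms(2) by (auto simp: loc2_def)
  let ?h1 = "cmul smul (ss_pow xysq K2) h1" and ?h2 = "cmul smul (ss_pow xysq K1) h2"
  have "weq (fmul ?p G1) (rep (K1 + K2) ?h1)" "weq (fmul ?p G1') (rep (K1 + K2) (swp ?h1))"
    using 1 rep_shift[of K1 _ K2] weq_trans by (auto simp: swp_cmul_xysq_pow)
  moreover have "weq (fmul ?p G2) (rep (K1 + K2) ?h2)" "weq (fmul ?p G2') (rep (K1 + K2) (swp ?h2))"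
    using 2 rep_shift[of K2 _ K1] weq_trans by (auto simp: swp_cmul_xysq_pow add.commute)
  ultimately show ?thesis unfolding loc2_def
    by (intro exI[of _ "K1 + K2"] exI[of _ "?h1 + ?h2"]) (simp add: fmul_add rep_add swp_add weq_add)
qed

text \<open>This carries locality over from Y(x,z) to z^n Y(x,z): the same factor multiplies both
  orders, seen through exchanged variables in the second.\<close>

lemma loc2_fmul:
  assumes "loc2 L G G'" shows "loc2 L (fmul p G) (fmul (swp p) G')"
proof -
  let ?p = "ss_pow xydiff_sq L"
  obtain K h where 1: "weq (fmul ?p G) (rep K h)" "weq (fmul ?p G') (rep K (swp h))"
    using assms(1) by (auto simp: loc2_def)
  have "weq (fmul ?p (fmul p G)) (rep K (cmul smul p h))"
    unfolding fmul_commute[of ?p] rep_fmul[symmetric] by (rule weq_fmul[OF 1(1)])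
  moreover have "weq (fmul ?p (fmul (swp p) G')) (rep K (swp (cmul smul p h)))"
    unfolding fmul_commute[of ?p] rep_fmul[symmetric] swp_cmul by (rule weq_fmul[OF 1(2)])
  ultimately show ?thesis unfolding loc2_def by blast
qed

lemma loc2_fscale:
  assumes "loc2 L G G'" shows "loc2 L (fscale c G) (fscale c G')"
proof -
  let ?p = "ss_pow xydiff_sq L"
  obtain K h where 1: "weq (fmul ?p G) (rep K h)" "weq (fmul ?p G') (rep K (swp h))"
    using assms(1) by (auto simp: loc2_def)
  have "weq (fmul ?p (fscale c G)) (rep K (\<lambda>m. smul c (h m)))"
    unfolding fmul_scale rep_fscale[symmetric] by (rule weq_fscale[OF 1(1)])
  moreover have "weq (fmul ?p (fscale c G')) (rep K (swp (\<lambda>m. smul c (h m))))"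
    unfolding fmul_scale swp_scale rep_fscale[symmetric] by (rule weq_fscale[OF 1(2)])
  ultimately show ?thesis unfolding loc2_def by blast
qed

lemma loc2_mono:
  assumes "loc2 L G G'" "L \<le> L'" shows "loc2 L' G G'"
proof -
  obtain j where j: "L' = L + j" using assms(2) le_iff_add by blast
  have "loc2 L (fmul (ss_pow xydiff_sq j) G) (fmul (ss_pow xydiff_sq j) G')"
    using loc2_fmul[OF assms(1), of "ss_pow xydiff_sq j"] by (simp add: swp_ss_pow)
  then show ?thesis by (simp add: loc2_def j fmul_pow_add)
qed

lemma locfam_add:
  assumes "locfam G1 G1'" "locfam G2 G2'"
  shows "locfam (\<lambda>c. G1 c + G2 c) (\<lambda>c. G1' c + G2' c)"
proof -
  obtain L1 L2 where "\<And>c. loc2 L1 (G1 c) (G1' c)" "\<And>c. loc2 L2 (G2 c) (G2' c)"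
    using assms by (auto simp: locfam_def)
  then have "loc2 (max L1 L2) (G1 c + G2 c) (G1' c + G2' c)" for c
    by (meson loc2_add loc2_mono max.cobounded1 max.cobounded2)
  then show ?thesis unfolding locfam_def by blast
qed

lemma locfam_fmul: "locfam G G' \<Longrightarrow> locfam (\<lambda>c. fmul p (G c)) (\<lambda>c. fmul (swp p) (G' c))"
  unfolding locfam_def using loc2_fmul by blast

lemma locfam_cong:
  "locfam G G' \<Longrightarrow> (\<And>c. weq (G c) (H c)) \<Longrightarrow> (\<And>c. weq (G' c) (H' c)) \<Longrightarrow> locfam H H'"
  unfolding locfam_def using loc2_cong by blast

lemma locfam_sum:
  assumes "\<And>s. s \<in> S \<Longrightarrow> locfam (G s) (G' s)"
  shows "locfam (\<lambda>c. \<Sum>s\<in>S. G s c) (\<lambda>c. \<Sum>s\<in>S. G' s c)"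
  using assms
proof (induction S rule: infinite_finite_induct)
  case (insert x S)
  then show ?case
    unfolding sum.insert[OF insert(1,2)] by (intro locfam_add) auto
qed (simp_all add: locfam_def)

end

section \<open>Locality in vertex algebras\<close>

lemma sgr_eq: "sgr P v = P v + P v - v"
  by (simp add: sgr_def)

locale vertex_algebra_loc = complex_vector_space smul
  for smul :: "complex \<Rightarrow> 'v::ab_group_add \<Rightarrow> 'v" +
  fixes P :: "'v \<Rightarrow> 'v"
    and Y :: "'v \<Rightarrow> 'v \<Rightarrow> ('d::finite, 'v) ls"
    and T :: "'d \<Rightarrow> 'v \<Rightarrow> 'v"
    and vac :: 'v
  assumes VA: "vertex_algebra smul P Y T vac"
begin

section \<open>Parity operator, linearity and numerators of vertex operators\<close>

abbreviation lin :: "('v \<Rightarrow> 'v) \<Rightarrow> bool" where "lin \<equiv> Vector_Spaces.linear smul smul"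

lemma lin_iff: "lin f \<longleftrightarrow> (\<forall>v w. f (v + w) = f v + f w) \<and> (\<forall>c v. f (smul c v) = smul c (f v))"
  by (auto simp: Vector_Spaces.linear_iff vector_space_axioms)

lemma lin_0: "lin f \<Longrightarrow> f 0 = 0"
  using lin_iff[of f] by (metis scale_zero_left)

lemma lin_diff: "lin f \<Longrightarrow> f (v - w) = f v - f w"
  using lin_iff[of f] by (metis add_diff_cancel_right' diff_add_cancel)

lemma lin_sum: "lin f \<Longrightarrow> f (\<Sum>s\<in>S. g s) = (\<Sum>s\<in>S. f (g s))"
  using lin_0[of f] lin_iff[of f] by (induction S rule: infinite_finite_induct) auto

abbreviation s where "s \<equiv> sgr P"

lemma lin_P: "lin P" and P_P [simp]: "P (P v) = P v"
  using VA by (auto simp: vertex_algebra_def is_superspace_def)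

lemma lin_s: "lin s"
  using lin_P by (simp add: lin_iff sgr_eq scale_right_distrib scale_right_diff_distrib)

lemma s_zero [simp]: "s 0 = 0"
  by (rule lin_0[OF lin_s])

lemma s_s [simp]: "s (s v) = v"
  using lin_P lin_diff[OF lin_P] by (simp add: sgr_eq lin_iff)

lemma half_double: "smul (1/2) (v + v) = v"
  by (simp flip: scale_left_distrib add: scale_right_distrib)

lemma P_eq: "P v = smul (1/2) (v + s v)"
  by (simp add: sgr_eq half_double)

lemma odd_part_eq: "v - P v = smul (1/2) (v - s v)"
proof -
  have "v - s v = (v - P v) + (v - P v)" by (simp add: sgr_eq)
  then show ?thesis by (simp only: half_double)
qed

lemma Y_linear: "ls_linear (Y a)"
  using VA by (auto simp: vertex_algebra_def ls_linear_def)

lemma Y_add: "ls_eq smul (Y (a + a') b) (ls_add smul (Y a b) (Y a' b))"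
  and Y_scale: "ls_eq smul (Y (smul c a) b) (ls_scale smul c (Y a b))"
  and Y_sgr: "ls_eq smul (Y (s a) (s b)) (ls_map s (Y a b))"
  using VA by (auto simp: vertex_algebra_def)

lemma lin_T: "lin (T \<alpha>)" and T_commute: "T \<alpha> (T \<beta> v) = T \<beta> (T \<alpha> v)"
  and T_vac [simp]: "T \<alpha> vac = 0"
  using VA by (auto simp: vertex_algebra_def)

lemma s_vac [simp]: "s vac = vac"
  using VA by (auto simp: vertex_algebra_def is_even_def sgr_eq)

lemma Y_vac: "ls_eq smul (Y vac a) (0, \<lambda>n. if n = mi0 then a else 0)"
  and Y_on_vac: "\<exists>g. ls_eq smul (Y a vac) (0, g) \<and> g mi0 = a"
  and translation: "ls_eq smul (scomm smul P (T \<alpha>) (Y a) b) (ls_deriv smul \<alpha> (Y a b))"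
  using VA by (auto simp: vertex_algebra_def)

lemma nu_Y_add: "\<forall>\<^sub>F N in sequentially. nu (Y (a + a') b) N = nu (Y a b) N + nu (Y a' b) N"
  using Y_add[of a a' b, unfolded eventually_ls_eq] nu_add[of "Y a b" "Y a' b"]
  by eventually_elim simp

lemma nu_Y_scale: "\<forall>\<^sub>F N in sequentially. nu (Y (smul c a) b) N = (\<lambda>n. smul c (nu (Y a b) N n))"
  using Y_scale[of c a b, unfolded eventually_ls_eq]
  by eventually_elim (simp add: nu_scale)

lemma nu_Y_zero: "\<forall>\<^sub>F N in sequentially. nu (Y 0 b) N = 0"
  using nu_Y_scale[of 0 0 b] by simp

lemma nu_Y_sgr: "\<forall>\<^sub>F N in sequentially. nu (Y (s a) b) N = (\<lambda>n. s (nu (Y a (s b)) N n))"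
  using Y_sgr[of a "s b", unfolded eventually_ls_eq]
  by eventually_elim (simp add: nu_map[OF lin_s])

lemma nu_fld_even:
  "\<forall>\<^sub>F N in sequentially. nu (fld_even smul P A c) N
     = (\<lambda>n. smul (1/2) (nu (A c) N n + s (nu (A (s c)) N n)))"
  using nu_add[of "A c" "ls_map s (A (s c))"]
  by eventually_elim (simp add: fld_even_def nu_scale nu_map[OF lin_s])

lemma nu_fld_odd:
  "\<forall>\<^sub>F N in sequentially. nu (fld_odd smul P A c) N
     = (\<lambda>n. smul (1/2) (nu (A c) N n - s (nu (A (s c)) N n)))"
  using nu_add[of "A c" "ls_scale smul (-1) (ls_map s (A (s c)))"]
  by eventually_elim (simp add: fld_odd_def nu_scale nu_map[OF lin_s])

lemma nu_fld_conj: "nu (fld_conj P B v) N = (\<lambda>n. s (nu (B (s v)) N n))"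
  by (simp add: fld_conj_def nu_map[OF lin_s])

text \<open>Because Y is even, conjugation by the parity operator can be moved onto b. The twisted
  field in the reversed product is thus again a vertex operator, and in particular linear.\<close>

lemma fld_conj_Y: "ls_eq smul (fld_conj P (Y b) v) (Y (s b) v)"
  unfolding eventually_ls_eq nu_fld_conj using nu_Y_sgr[of b v] by eventually_elim simp

lemma ls_linear_cong:
  assumes "ls_linear A" "\<And>v. ls_eq smul (A v) (B v)" shows "ls_linear B"
proof -
  have e: "\<forall>\<^sub>F N in sequentially. nu (A v) N = nu (B v) N" for v
    using assms(2) by (simp add: eventually_ls_eq)
  show ?thesis unfolding ls_linear_iff
  proof (intro conjI allI)
    fix v w
    show "\<forall>\<^sub>F N in sequentially. nu (B (v + w)) N = nu (B v) N + nu (B w) N"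
      using ls_linear_add[OF assms(1), of v w] e[of v] e[of w] e[of "v + w"] by eventually_elim simp
  next
    fix c v
    show "\<forall>\<^sub>F N in sequentially. nu (B (smul c v)) N = (\<lambda>n. smul c (nu (B v) N n))"
      using ls_linear_scale[OF assms(1), of c v] e[of v] e[of "smul c v"] by eventually_elim simp
  qed
qed

lemma fld_conj_Y_linear: "ls_linear (fld_conj P (Y b))"
  using ls_linear_cong[OF Y_linear ls_eq_sym[OF fld_conj_Y]] .

lemma lin_op_even: "lin X \<Longrightarrow> lin (op_even smul P X)"
  using lin_s by (simp add: lin_iff op_even_def scale_right_distrib mult.commute algebra_simps)

lemma lin_op_odd: "lin X \<Longrightarrow> lin (op_odd smul P X)"
  using lin_s
  by (simp add: lin_iff op_odd_def lin_diff scale_right_distrib scale_right_diff_distrib mult.commute algebra_simps)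

lemma op_even_plus_odd: "op_even smul P X v + op_odd smul P X v = X v"
proof -
  have "op_even smul P X v + op_odd smul P X v = smul (1/2) (X v + X v)"
    by (simp add: op_even_def op_odd_def flip: scale_right_distrib)
  then show ?thesis by (simp only: half_double)
qed

lemma nu_scomm:
  assumes "lin X"
  shows "\<forall>\<^sub>F N in sequentially. nu (scomm smul P X A c) N
    = (\<lambda>n. X (nu (A c) N n) - (nu (A (op_even smul P X c)) N n + s (nu (A (s (op_odd smul P X c))) N n)))"
  using nu_add[of "ls_map X (A c)" "ls_scale smul (-1) (ls_add smul (A (op_even smul P X c)) (ls_map s (A (s (op_odd smul P X c)))))"]
    nu_add[of "A (op_even smul P X c)" "ls_map s (A (s (op_odd smul P X c)))"]
  by eventually_elim (simp add: scomm_def nu_scale nu_map[OF lin_s] nu_map[OF assms] fun_eq_iff)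

lemma scomm_linear:
  assumes X: "lin X" and A: "ls_linear A"
  shows "ls_linear (scomm smul P X A)"
  unfolding ls_linear_iff
proof (intro conjI allI)
  fix v w
  let ?e = "op_even smul P X" and ?o = "op_odd smul P X"
  have 1: "X (a + b) = X a + X b" "?e (a + b) = ?e a + ?e b" "?o (a + b) = ?o a + ?o b" 
    "s (a + b) = s a + s b" for a b
    using X lin_op_even[OF X] lin_op_odd[OF X] lin_s by (simp_all add: lin_iff)
  show "\<forall>\<^sub>F N in sequentially. nu (scomm smul P X A (v + w)) N
      = nu (scomm smul P X A v) N + nu (scomm smul P X A w) N"
    using nu_scomm[OF X, of A v] nu_scomm[OF X, of A w] nu_scomm[OF X, of A "v + w"]
      ls_linear_add[OF A, of v w] ls_linear_add[OF A, of "?e v" "?e w"]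
      ls_linear_add[OF A, of "s (?o v)" "s (?o w)"]
    by eventually_elim (simp add: fun_eq_iff 1)
next
  fix c v
  let ?e = "op_even smul P X" and ?o = "op_odd smul P X"
  have 1: "X (smul c a) = smul c (X a)" "?e (smul c a) = smul c (?e a)" "?o (smul c a) = smul c (?o a)" 
    "s (smul c a) = smul c (s a)" for a
    using X lin_op_even[OF X] lin_op_odd[OF X] lin_s by (simp_all add: lin_iff)
  show "\<forall>\<^sub>F N in sequentially. nu (scomm smul P X A (smul c v)) N
      = (\<lambda>n. smul c (nu (scomm smul P X A v) N n))"
    using nu_scomm[OF X, of A v] nu_scomm[OF X, of A "smul c v"]
      ls_linear_scale[OF A, of c v] ls_linear_scale[OF A, of c "?e v"]
      ls_linear_scale[OF A, of c "s (?o v)"]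
    by eventually_elim (simp add: fun_eq_iff 1 scale_right_distrib scale_right_diff_distrib)
qed

subsection \<open>Mutual locality of fields\<close>

text \<open>The family of the signed reversed product \<open>sprod_swap\<close>: the even part of A
  passes B unchanged, the odd part meets B_0 - B_1.\<close>

definition swapped :: "('v \<Rightarrow> ('d,'v) ls) \<Rightarrow> ('v \<Rightarrow> ('d,'v) ls) \<Rightarrow> 'v \<Rightarrow> ('d,'v) fam" where
  "swapped B A c = fcomp B (fld_even smul P A c) + fcomp (fld_conj P B) (fld_odd smul P A c)"

lemma local_op_iff:
  assumes X: "lin X"
  shows "local_op smul P Y X \<longleftrightarrow>
    (\<forall>a b. locfam (\<lambda>c. fcomp (scomm smul P X (Y a)) (Y b c)) (\<lambda>c. swapped (Y b) (scomm smul P X (Y a)) c))"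
proof -
  have 1: "weq (wnum (prod2 (scomm smul P X (Y a)) (Y b) c)) (fcomp (scomm smul P X (Y a)) (Y b c))" for a b c
    by (rule wnum_prod2[OF scomm_linear[OF X Y_linear]])
  have 2: "weq (wnum (sprod_swap smul P (Y b) A c)) (swapped (Y b) A c)" for A b c
    unfolding sprod_swap_def swapped_def
    by (rule weq_trans[OF wnum_wadd weq_add]) (rule wnum_prod2[OF Y_linear] wnum_prod2[OF fld_conj_Y_linear])+
  show ?thesis
    unfolding local_op_def lands_iff loc2_def[symmetric] locfam_def
    using loc2_cong[OF _ 1 2] loc2_cong[OF _ weq_sym[OF 1] weq_sym[OF 2]] by meson
qed

lemma locfam_homogeneous:
  assumes "is_even P a \<or> is_odd P a" "is_even P b \<or> is_odd P b"
  shows "locfam (\<lambda>c. fcomp (Y a) (Y b c))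
    (\<lambda>c. fscale (if is_odd P a \<and> is_odd P b then -1 else 1) (fcomp (Y b) (Y a c)))"
proof -
  define \<epsilon> :: complex where "\<epsilon> = (if is_odd P a \<and> is_odd P b then -1 else 1)"
  have "\<exists>N. \<forall>c. \<exists>K h K' h'.
           lands smul N (prod2 (Y a) (Y b) c) K h \<and>
           lands smul N (prod2 (Y b) (Y a) c) K' h' \<and>
           eq2 smul (K, h) (K', \<lambda>m. smul \<epsilon> (swp h' m))"
    using VA assms unfolding vertex_algebra_def \<epsilon>_def by blast
  then obtain L where L: "\<And>c. \<exists>K h K' h'.
           lands smul L (prod2 (Y a) (Y b) c) K h \<and>
           lands smul L (prod2 (Y b) (Y a) c) K' h' \<and>
           eq2 smul (K, h) (K', \<lambda>m. smul \<epsilon> (swp h' m))" by blast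
  have "loc2 L (fcomp (Y a) (Y b c)) (fscale \<epsilon> (fcomp (Y b) (Y a c)))" for c
  proof -
    let ?p = "ss_pow xydiff_sq L"
    obtain K h K' h' where *: "lands smul L (prod2 (Y a) (Y b) c) K h"
       "lands smul L (prod2 (Y b) (Y a) c) K' h'" "eq2 smul (K, h) (K', \<lambda>m. smul \<epsilon> (swp h' m))"
      using L by blast
    obtain k where k: "cmul smul (ss_pow xysq (K' + k)) h
        = cmul smul (ss_pow xysq (K + k)) (\<lambda>m. smul \<epsilon> (swp h' m))"
      using *(3) by (auto simp: eq2_def)
    \<comment> \<open>The denominators K and K' of the two orders and the witness k of
      \<open>eq2\<close> are merged into the common exponent K + K' + k, for which this is the
      numerator.\<close>
    let ?h = "cmul smul (ss_pow xysq (K' + k)) h"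
    have sh: "swp ?h = cmul smul (ss_pow xysq (K + k)) (\<lambda>m. smul \<epsilon> (h' m))"
      unfolding k swp_cmul_xysq_pow swp_scale by simp
    have "weq (fmul ?p (wnum (prod2 (Y a) (Y b) c))) (rep (K + (K' + k)) ?h)"
      using *(1) rep_shift weq_trans unfolding lands_iff by blast
    moreover have "weq (fscale \<epsilon> (fmul ?p (wnum (prod2 (Y b) (Y a) c)))) (rep K' (\<lambda>m. smul \<epsilon> (h' m)))"
      unfolding rep_fscale[symmetric] using *(2)[unfolded lands_iff] by (rule weq_fscale)
    then have "weq (fmul ?p (fscale \<epsilon> (wnum (prod2 (Y b) (Y a) c)))) (rep (K' + (K + k)) (swp ?h))"
      unfolding fmul_scale sh using rep_shift weq_trans by blast
    moreover have "K' + (K + k) = K + (K' + k)" by simp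
    ultimately have "loc2 L (wnum (prod2 (Y a) (Y b) c)) (fscale \<epsilon> (wnum (prod2 (Y b) (Y a) c)))"
      unfolding loc2_def by metis
    then show ?thesis
      by (rule loc2_cong) (intro weq_fscale wnum_prod2 Y_linear)+
  qed
  then show ?thesis unfolding locfam_def \<epsilon>_def by blast
qed

lemma fcomp_zero_left: 
  assumes "\<And>v. \<forall>\<^sub>F N in sequentially. nu (A v) N = 0" shows "weq (fcomp A u) 0"
  using assms by (intro weqI) (simp add: sleq_def slice_fcomp)

lemma fcomp_zero_right: 
  assumes "ls_linear A" "\<forall>\<^sub>F N in sequentially. nu u N = 0" shows "weq (fcomp A u) 0"
  using assms(2) unfolding weq_def
  by eventually_elim (use ls_linear_0[OF assms(1)] in \<open>simp add: sleq_def slice_fcomp\<close>)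

lemma fscale_1 [simp]: "fscale 1 G = G"
  by (simp add: fscale_def)

text \<open>The zero vector counts both as even and as odd, so the sign in
  \<open>locfam_homogeneous\<close> can be -1 for an even vector that is 0. Both products vanish in
  that case, which is settled here.\<close>

lemma locfam_zero:
  assumes "a = 0 \<or> b = 0"
  shows "locfam (\<lambda>c. fcomp (Y a) (Y b c)) (\<lambda>c. fcomp (Y b) (Y a c))"
proof -
  have "weq 0 (fcomp (Y 0) u)" "weq 0 (fcomp (Y v) (Y 0 c))" for u c v
    by (rule weq_sym, rule fcomp_zero_left, rule nu_Y_zero)
      (rule weq_sym, rule fcomp_zero_right[OF Y_linear nu_Y_zero])
  then have z: "weq 0 (fcomp (Y a) (Y b c))" "weq 0 (fcomp (Y b) (Y a c))" for c
    using assms by metis+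
  have "loc2 0 (fcomp (Y a) (Y b c)) (fcomp (Y b) (Y a c))" for c
    by (rule loc2_cong[OF loc2_zero z])
  then show ?thesis unfolding locfam_def by blast
qed

lemma locfam_even_left:
  assumes "is_even P a" "is_even P b \<or> is_odd P b"
  shows "locfam (\<lambda>c. fcomp (Y a) (Y b c)) (\<lambda>c. fcomp (Y b) (Y a c))"
proof (cases "a = 0")
  case False
  then have "\<not> is_odd P a" using assms by (auto simp: is_even_def is_odd_def)
  then show ?thesis using locfam_homogeneous[of a b] assms by simp
qed (rule locfam_zero, simp)

lemma locfam_even_right:
  assumes "is_even P a \<or> is_odd P a" "is_even P b"
  shows "locfam (\<lambda>c. fcomp (Y a) (Y b c)) (\<lambda>c. fcomp (Y b) (Y a c))"
proof (cases "b = 0")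
  case False
  then have "\<not> is_odd P b" using assms by (auto simp: is_even_def is_odd_def)
  then show ?thesis using locfam_homogeneous[of a b] assms by simp
qed (rule locfam_zero, simp)

lemma fcomp_Y_add_left: "weq (fcomp (Y (a + a')) u) (fcomp (Y a) u + fcomp (Y a') u)"
  using fcomp_cong_left[OF Y_add] fcomp_add_left by (rule weq_trans)

lemma fcomp_Y_scale_left: "weq (fcomp (Y (smul k a)) u) (fscale k (fcomp (Y a) u))"
proof (intro weqI)
  fix M
  have e: "slice (fscale k (fcomp (Y a) u) M N) n = (\<lambda>e. smul k (nu (Y a (nu u M n)) N e))" for N n
    by (rule ext) (simp add: fscale_def slice_def flip: slice_fcomp)
  show "sleq (fcomp (Y (smul k a)) u M) (fscale k (fcomp (Y a) u) M)"
    unfolding sleq_def slice_fcomp e using nu_Y_scale by blast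
qed

lemma fcomp_Y_add_right: 
  "ls_linear A \<Longrightarrow> weq (fcomp A (Y (a + a') c)) (fcomp A (Y a c) + fcomp A (Y a' c))"
  using fcomp_cong_right[OF Y_add] fcomp_add_right weq_trans by blast

text \<open>The locality axiom speaks of homogeneous vectors. Of the four products of homogeneous
  parts only odd with odd changes sign, and s b = b0 - b1 collects exactly this sign.\<close>

lemma locfam_Y:
  "locfam (\<lambda>c. fcomp (Y x) (Y b c))
    (\<lambda>c. fcomp (Y b) (Y (P x) c) + fcomp (fld_conj P (Y b)) (Y (x - P x) c))"
proof -
  define x0 x1 b0 b1 where "x0 = P x" and "x1 = x - P x" and "b0 = P b" and "b1 = b - P b"
  have par: "is_even P x0" "is_odd P x1" "is_even P b0" "is_odd P b1"
    by (simp_all add: x0_def x1_def b0_def b1_def is_even_def is_odd_def lin_diff[OF lin_P])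
  have x: "x = x0 + x1" and b: "b = b0 + b1" and sb: "s b = b0 + smul (-1) b1"
    by (simp_all add: x0_def x1_def b0_def b1_def sgr_eq)
  let ?f = "\<lambda>a b c. fcomp (Y a) (Y b c)"
  have "locfam (\<lambda>c. (?f x0 b0 c + ?f x0 b1 c) + (?f x1 b0 c + ?f x1 b1 c))
     (\<lambda>c. (?f b0 x0 c + ?f b1 x0 c) + (?f b0 x1 c + fscale (-1) (?f b1 x1 c)))"
    using par locfam_homogeneous[of x1 b1] 
    by (intro locfam_add locfam_even_left locfam_even_right) auto
  moreover have "weq (?f x b c) ((?f x0 b0 c + ?f x0 b1 c) + (?f x1 b0 c + ?f x1 b1 c))" for c
    unfolding x b
    by (rule weq_trans[OF fcomp_Y_add_left weq_add]; rule fcomp_Y_add_right[OF Y_linear])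
  moreover have "weq (fcomp (Y b) (Y x0 c) + fcomp (fld_conj P (Y b)) (Y x1 c))
     ((?f b0 x0 c + ?f b1 x0 c) + (?f b0 x1 c + fscale (-1) (?f b1 x1 c)))" for c
  proof (rule weq_add)
    show "weq (fcomp (Y b) (Y x0 c)) (?f b0 x0 c + ?f b1 x0 c)"
      unfolding b by (rule fcomp_Y_add_left)
    have "weq (fcomp (fld_conj P (Y b)) (Y x1 c)) (fcomp (Y (s b)) (Y x1 c))"
      by (rule fcomp_cong_left[OF fld_conj_Y])
    also have "weq \<dots> (?f b0 x1 c + fcomp (Y (smul (-1) b1)) (Y x1 c))"
      unfolding sb by (rule fcomp_Y_add_left)
    also have "weq \<dots> (?f b0 x1 c + fscale (-1) (?f b1 x1 c))"
      by (rule weq_add[OF weq_refl fcomp_Y_scale_left])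
    finally show "weq (fcomp (fld_conj P (Y b)) (Y x1 c)) (?f b0 x1 c + fscale (-1) (?f b1 x1 c))" .
  qed
  ultimately have "locfam (?f x b) (\<lambda>c. fcomp (Y b) (Y x0 c) + fcomp (fld_conj P (Y b)) (Y x1 c))"
    by (blast intro: locfam_cong weq_sym)
  then show ?thesis unfolding x0_def x1_def .
qed

text \<open>\<open>Ysub\<close> sums over the support of x. With a free index set S, the parity
  parts of x, whose supports may be smaller, can be summed over the same S.\<close>

abbreviation Ysum :: "'d mi set \<Rightarrow> ('d mi \<Rightarrow> 'v) \<Rightarrow> 'v \<Rightarrow> ('d,'v) ls" where
  "Ysum S x c \<equiv> ls_sum smul S (\<lambda>n. ls_cmul smul (smono n) (Y (x n) c))"

lemma nu_Ysum:
  "finite S \<Longrightarrow> \<forall>\<^sub>F N in sequentially. nu (Ysum S x c) N = (\<Sum>n\<in>S. cmul smul (smono n) (nu (Y (x n) c) N))"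
  using nu_sum[of S "\<lambda>n. ls_cmul smul (smono n) (Y (x n) c)"] by (simp add: nu_cmul)

lemma nu_Y_even_part:
  "\<forall>\<^sub>F N in sequentially. nu (Y (P x) c) N = (\<lambda>n. smul (1/2) (nu (Y x c) N n + s (nu (Y x (s c)) N n)))"
  using nu_Y_scale[of "1/2" "x + s x" c] nu_Y_add[of x "s x" c] nu_Y_sgr[of x c]
  by eventually_elim (simp add: P_eq fun_eq_iff)

lemma nu_Y_odd_part:
  "\<forall>\<^sub>F N in sequentially. nu (Y (x - P x) c) N = (\<lambda>n. smul (1/2) (nu (Y x c) N n - s (nu (Y x (s c)) N n)))"
  using nu_Y_scale[of "1/2" "x - s x" c] nu_Y_add[of "x - s x" "s x" c] nu_Y_sgr[of x c]
  by eventually_elim (simp add: odd_part_eq fun_eq_iff algebra_simps)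

text \<open>The monomials z^n carry no parity, so the even part of the field is obtained by
  projecting each vector x n.\<close>

lemma fld_even_Ysum:
  assumes S: "finite S" and B: "\<And>v. ls_eq smul (B v) (Ysum S x v)"
  shows "ls_eq smul (fld_even smul P B c) (Ysum S (\<lambda>n. P (x n)) c)"
proof -
  have b: "\<forall>\<^sub>F N in sequentially. nu (B v) N = nu (Ysum S x v) N" for v
    using B by (simp add: eventually_ls_eq)
  have "\<forall>\<^sub>F N in sequentially. \<forall>n\<in>S. nu (Y (P (x n)) c) N
      = (\<lambda>m. smul (1/2) (nu (Y (x n) c) N m + s (nu (Y (x n) (s c)) N m)))"
    using S nu_Y_even_part by (intro eventually_ball_finite) auto
  then show ?thesis unfolding eventually_ls_eq
    using nu_fld_even[of B c] nu_Ysum[OF S, of x c] nu_Ysum[OF S, of x "s c"]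
      nu_Ysum[OF S, of "\<lambda>n. P (x n)" c] b[of c] b[of "s c"]
  proof eventually_elim
    case (elim N)
    have "nu (fld_even smul P B c) N m = nu (Ysum S (\<lambda>n. P (x n)) c) N m" for m
      using elim
      by (simp add: sum_fun_apply lin_sum[OF lin_s] cmul_smono  if_distrib[of s]
          scale_sum_right flip: sum.distrib) (intro sum.cong, auto)
    then show ?case by blast
  qed
qed

lemma fld_odd_Ysum:
  assumes S: "finite S" and B: "\<And>v. ls_eq smul (B v) (Ysum S x v)"
  shows "ls_eq smul (fld_odd smul P B c) (Ysum S (\<lambda>n. x n - P (x n)) c)"
proof -
  have b: "\<forall>\<^sub>F N in sequentially. nu (B v) N = nu (Ysum S x v) N" for v
    using B by (simp add: eventually_ls_eq)
  have "\<forall>\<^sub>F N in sequentially. \<forall>n\<in>S. nu (Y (x n - P (x n)) c) N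
      = (\<lambda>m. smul (1/2) (nu (Y (x n) c) N m - s (nu (Y (x n) (s c)) N m)))"
    using S nu_Y_odd_part by (intro eventually_ball_finite) auto
  then show ?thesis unfolding eventually_ls_eq
    using nu_fld_odd[of B c] nu_Ysum[OF S, of x c] nu_Ysum[OF S, of x "s c"]
      nu_Ysum[OF S, of "\<lambda>n. x n - P (x n)" c] b[of c] b[of "s c"]
  proof eventually_elim
    case (elim N)
    have "nu (fld_odd smul P B c) N m = nu (Ysum S (\<lambda>n. x n - P (x n)) c) N m" for m
      using elim
      by (simp add: sum_fun_apply lin_sum[OF lin_s] cmul_smono  if_distrib[of s]
          scale_sum_right flip: sum_subtractf) (intro sum.cong, auto)
    then show ?case by blast
  qed
qed

lemma fcomp_Ysum_right:
  assumes "finite S" "ls_linear A"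
  shows "weq (fcomp A (Ysum S x c)) (\<Sum>n\<in>S. fmul (swp (xser (smono n))) (fcomp A (Y (x n) c)))"
  by (rule weq_trans[OF fcomp_sum_right[OF assms(2,1)] weq_sum]) (rule fcomp_cmul_right[OF assms(2)])

text \<open>B is any field equivalent to the finite sum, so the lemma applies to Y(X(z)a,z) itself
  and, under (ii), to [X,Y(a,z)].\<close>

lemma locfam_Ysum:
  assumes S: "finite S" and B: "\<And>v. ls_eq smul (B v) (Ysum S x v)"
  shows "locfam (\<lambda>c. fcomp B (Y b c)) (\<lambda>c. swapped (Y b) B c)"
proof -
  let ?C = "fld_conj P (Y b)"
  have "locfam (\<lambda>c. \<Sum>n\<in>S. fmul (xser (smono n)) (fcomp (Y (x n)) (Y b c)))
    (\<lambda>c. \<Sum>n\<in>S. fmul (swp (xser (smono n))) (fcomp (Y b) (Y (P (x n)) c) + fcomp ?C (Y (x n - P (x n)) c)))"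
    by (intro locfam_sum locfam_fmul locfam_Y)
  moreover have "weq (fcomp B (Y b c)) (\<Sum>n\<in>S. fmul (xser (smono n)) (fcomp (Y (x n)) (Y b c)))" for c
    using fcomp_cong_left[OF B] fcomp_sum_cmul_left[OF S] by (rule weq_trans)
  moreover have "weq (swapped (Y b) B c)
    (\<Sum>n\<in>S. fmul (swp (xser (smono n))) (fcomp (Y b) (Y (P (x n)) c) + fcomp ?C (Y (x n - P (x n)) c)))" for c
    unfolding swapped_def fmul_add sum.distrib
    using weq_trans[OF fcomp_cong_right[OF fld_even_Ysum[OF S B]] fcomp_Ysum_right[OF S Y_linear]]
      weq_trans[OF fcomp_cong_right[OF fld_odd_Ysum[OF S B]] fcomp_Ysum_right[OF S fld_conj_Y_linear]]
    by (rule weq_add)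
  ultimately show ?thesis by (blast intro: locfam_cong weq_sym)
qed

text \<open>The parity operator fixes 1, so the even and odd parts of A, evaluated at 1, involve A
  at no other vector.\<close>

lemma swapped_vac_cong:
  assumes "ls_eq smul (A vac) (B vac)" "ls_linear D" "ls_linear (fld_conj P D)"
  shows "weq (swapped D A vac) (swapped D B vac)"
  unfolding swapped_def
proof (intro weq_add fcomp_cong_right)
  show "ls_eq smul (fld_even smul P A vac) (fld_even smul P B vac)"
    using assms(1) nu_fld_even[of A vac] nu_fld_even[of B vac] unfolding eventually_ls_eq
    by eventually_elim simp
  show "ls_eq smul (fld_odd smul P A vac) (fld_odd smul P B vac)"
    using assms(1) nu_fld_odd[of A vac] nu_fld_odd[of B vac] unfolding eventually_ls_eq
    by eventually_elim simp
qed

end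
section \<open>Leibniz rules\<close>

context complex_vector_space
begin

text \<open>The indices n on the left that are not below m satisfy n a = m a + 1 and therefore have
  weight 0.\<close>

lemma sum_mi_leibniz_right:
  fixes f :: "'i::finite mi \<Rightarrow> 'i mi \<Rightarrow> 'v"
  shows "(\<Sum>n\<in>{n. n \<le> m + mi_delta a}. smul (of_nat ((m + mi_delta a - n) a)) (f n (m + mi_delta a - n)))
    = (\<Sum>n\<in>{n. n \<le> m}. smul (of_nat ((m - n) a + 1)) (f n (m - n + mi_delta a)))"
proof (rule sum.mono_neutral_cong_right)
  show "{n. n \<le> m} \<subseteq> {n. n \<le> m + mi_delta a}" by (auto intro: order_trans)
  show "\<forall>n\<in>{n. n \<le> m + mi_delta a} - {n. n \<le> m}.
      smul (of_nat ((m + mi_delta a - n) a)) (f n (m + mi_delta a - n)) = 0"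
  proof
    fix n assume "n \<in> {n. n \<le> m + mi_delta a} - {n. n \<le> m}"
    then have le: "n \<le> m + mi_delta a" and "\<not> n \<le> m" by auto
    then obtain i where i: "m i < n i" by (auto simp: le_fun_def not_le)
    moreover have "n i \<le> m i + mi_delta a i" using le by (simp add: le_fun_def)
    ultimately have "i = a" by (cases "i = a") auto
    then show "smul (of_nat ((m + mi_delta a - n) a)) (f n (m + mi_delta a - n)) = 0"
      using i by simp
  qed
next
  fix n assume "n \<in> {n. n \<le> m}"
  then have "n \<le> m" by simp
  then have "m + mi_delta a - n = m - n + mi_delta a" "n a \<le> m a" by (auto simp: le_fun_def fun_eq_iff)
  then show "smul (of_nat ((m + mi_delta a - n) a)) (f n (m + mi_delta a - n))
    = smul (of_nat ((m - n) a + 1)) (f n (m - n + mi_delta a))" by simp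
qed simp

text \<open>The product rule for coefficients: m a + 1 is the sum of the two exponents at a. A
  general f covers both z^2 f(z) and e^{z.T} X(z) a.\<close>

lemma sum_mi_leibniz:
  fixes f :: "'i::finite mi \<Rightarrow> 'i mi \<Rightarrow> 'v"
  shows "smul (of_nat (m a + 1)) (\<Sum>n\<in>{n. n \<le> m + mi_delta a}. f n (m + mi_delta a - n))
    = (\<Sum>n\<in>{n. n \<le> m}. smul (of_nat ((m - n) a + 1)) (f n (m - n + mi_delta a)))
    + (\<Sum>n\<in>{n. n \<le> m}. smul (of_nat (n a + 1)) (f (n + mi_delta a) (m - n)))"
proof -
  let ?k = "m + mi_delta a"
  have "smul (of_nat (m a + 1)) (\<Sum>n\<in>{n. n \<le> ?k}. f n (?k - n))
    = (\<Sum>n\<in>{n. n \<le> ?k}. smul (of_nat ((?k - n) a)) (f n (?k - n)) + smul (of_nat (n a)) (f n (?k - n)))"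
    unfolding scale_sum_right
  proof (rule sum.cong[OF refl])
    fix n assume "n \<in> {n. n \<le> ?k}"
    then have "n a \<le> ?k a" unfolding le_fun_def by blast
    then have "m a + 1 = (?k - n) a + n a" by simp
    then show "smul (of_nat (m a + 1)) (f n (?k - n)) =
       smul (of_nat ((?k - n) a)) (f n (?k - n)) + smul (of_nat (n a)) (f n (?k - n))"
      by (metis of_nat_add scale_left_distrib)
  qed
  also have "\<dots> = (\<Sum>n\<in>{n. n \<le> ?k}. smul (of_nat ((?k - n) a)) (f n (?k - n)))
     + (\<Sum>n\<in>{n. n \<le> ?k}. smul (of_nat (n a)) (f n (?k - n)))"
    by (rule sum.distrib)
  also have "(\<Sum>n\<in>{n. n \<le> ?k}. smul (of_nat (n a)) (f n (?k - n)))
    = (\<Sum>n\<in>{n. n \<le> ?k}. smul (of_nat ((?k - n) a)) (f (?k - n) n))"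
    by (rule sum_mi_flip)
  also have "\<dots> = (\<Sum>n\<in>{n. n \<le> m}. smul (of_nat ((m - n) a + 1)) (f (m - n + mi_delta a) n))"
    by (rule sum_mi_leibniz_right[of m a "\<lambda>n k. f k n"])
  also have "\<dots> = (\<Sum>n\<in>{n. n \<le> m}. smul (of_nat (n a + 1)) (f (n + mi_delta a) (m - n)))"
    by (rule sum_mi_flip[of "\<lambda>n k. smul (of_nat (k a + 1)) (f (k + mi_delta a) n)" m])
  finally show ?thesis unfolding sum_mi_leibniz_right .
qed

text \<open>The formal partial derivative in the coordinate a.\<close>

definition dif :: "'i \<Rightarrow> ('i::finite mi \<Rightarrow> 'v) \<Rightarrow> 'i mi \<Rightarrow> 'v" where
  "dif a f = (\<lambda>m. smul (of_nat (m a + 1)) (f (m + mi_delta a)))"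

lemma zsq_add_delta: "zsq (n + mi_delta a) = smono (mi_delta a) (n :: 'd::finite mi)"
proof -
  have "(n + mi_delta a = (\<lambda>j. if j = i then 2 else 0)) \<longleftrightarrow> i = a \<and> n = mi_delta a" for i
  proof
    assume *: "n + mi_delta a = (\<lambda>j. if j = i then 2 else 0)"
    have "i = a" using fun_cong[OF *, of a] by (auto split: if_splits)
    moreover have "n j = mi_delta a j" for j
      using fun_cong[OF *, of j] \<open>i = a\<close> by (auto split: if_splits)
    ultimately show "i = a \<and> n = mi_delta a" by blast
  qed (auto simp: fun_eq_iff)
  then have "zsq (n + mi_delta a) = (\<Sum>i\<in>UNIV. if i = a then if n = mi_delta a then 1 else 0 else 0)"
    unfolding zsq_def ssq_def smono_def by (intro sum.cong) auto
  then show ?thesis by (simp add: smono_def)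
qed

lemma dif_cmul_zsq:
  "dif a (cmul smul zsq f) = (\<lambda>n. smul 2 (cmul smul (smono (mi_delta a)) f n)) + cmul smul zsq (dif a (f :: 'd::finite mi \<Rightarrow> 'v))"
proof
  fix m
  \<comment> \<open>This is d(z^2)/dz^a = 2 z^a: at n = \<open>mi_delta a\<close> the weight n a + 1
    equals 2.\<close>
  have "smul (of_nat (n a + 1) * zsq (n + mi_delta a)) v = smul 2 (smul (smono (mi_delta a) n) v)"
    for n :: "'d mi" and v
    by (simp add: zsq_add_delta smono_def)
  then have "(\<Sum>n\<in>{n. n \<le> m}. smul (of_nat (n a + 1)) (smul (zsq (n + mi_delta a)) (f (m - n))))
    = smul 2 (cmul smul (smono (mi_delta a)) f m)"
    unfolding cmul_eq scale_sum_right by (simp only: scale_scale)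
  moreover have "(\<Sum>n\<in>{n. n \<le> m}. smul (of_nat ((m - n) a + 1)) (smul (zsq n) (f (m - n + mi_delta a))))
    = cmul smul zsq (dif a f) m"
    unfolding cmul_eq dif_def by (simp add: mult.commute)
  ultimately show "dif a (cmul smul zsq f) m
    = ((\<lambda>n. smul 2 (cmul smul (smono (mi_delta a)) f n)) + cmul smul zsq (dif a f)) m"
    using sum_mi_leibniz[of m a "\<lambda>n k. smul (zsq n) (f k)"]
    by (simp add: dif_def[of a "cmul smul zsq f"] cmul_eq[of zsq f] add.commute)
qed

text \<open>The second summand is precisely the correction that the quotient rule in
  \<open>ls_deriv\<close> subtracts, so the derivative of a regular fraction is the derivative of
  its power series.\<close>

lemma cmul_zsq_dif_pow:
  "cmul smul zsq (dif a (cmul smul (ss_pow zsq N) g))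
   = cmul smul (ss_pow zsq (Suc N)) (dif a g)
     + (\<lambda>n. smul (of_nat (2 * N)) (cmul smul (smono (mi_delta a)) (cmul smul (ss_pow zsq N) (g :: 'd::finite mi \<Rightarrow> 'v)) n))"
proof (induction N)
  case 0
  show ?case by (simp add: cmul_pow_Suc)
next
  case (Suc N)
  let ?z = "cmul smul zsq" and ?F = "cmul smul (ss_pow zsq N) g" and ?d = "cmul smul (smono (mi_delta a))"
  have "?z (dif a (cmul smul (ss_pow zsq (Suc N)) g)) = ?z ((\<lambda>n. smul 2 (?d ?F n)) + ?z (dif a ?F))"
    by (simp only: cmul_pow_Suc dif_cmul_zsq)
  also have "\<dots> = (\<lambda>n. smul 2 (?d (?z ?F) n)) + ?z (?z (dif a ?F))"
    by (simp add: cmul_add cmul_scale cmul_commute)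
  also have "?z (?z (dif a ?F)) = cmul smul (ss_pow zsq (Suc (Suc N))) (dif a g)
     + (\<lambda>n. smul (of_nat (2 * N)) (?d (?z ?F) n))"
    unfolding Suc cmul_add cmul_scale by (simp add: cmul_pow_Suc cmul_commute)
  also have "(\<lambda>n. smul 2 (?d (?z ?F) n)) + (cmul smul (ss_pow zsq (Suc (Suc N))) (dif a g)
     + (\<lambda>n. smul (of_nat (2 * N)) (?d (?z ?F) n)))
    = cmul smul (ss_pow zsq (Suc (Suc N))) (dif a g)
     + (\<lambda>n. smul (of_nat (2 * Suc N)) (?d (?z ?F) n))"
    by (rule ext) (simp add: scale_left_distrib)
  finally show ?case by (simp only: cmul_pow_Suc)
qed

lemma ls_deriv_regular:
  assumes "ls_eq smul u (0, g)" shows "ls_eq smul (ls_deriv smul a u) (0, dif a (g :: 'd::finite mi \<Rightarrow> 'v))"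
proof -
  have "snd u = cmul smul (ss_pow zsq (fst u)) g"
    using ls_eqD[OF assms, of "fst u"] by (simp add: nu_def)
  moreover have "(\<lambda>m. smul (of_nat (m a + 1)) (snd u (m(a := m a + 1)))) = dif a (snd u)"
    unfolding dif_def mi_upd_eq ..
  then have "snd (ls_deriv smul a u) = (\<lambda>n. cmul smul zsq (dif a (snd u)) n
      - smul (of_nat (2 * fst u)) (cmul smul (smono (mi_delta a)) (snd u) n))"
    by (simp only: ls_deriv_def snd_conv)
  ultimately have "snd (ls_deriv smul a u) = cmul smul (ss_pow zsq (Suc (fst u))) (dif a g)"
    by (intro ext) (simp only: cmul_zsq_dif_pow plus_fun_apply add_diff_cancel_right')
  then show ?thesis
    unfolding ls_eq_iff_nu by (intro exI[of _ 0]) (simp add: nu_def ls_deriv_def)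
qed

end

section \<open>The exponential of the adjoint action\<close>

lemma (in complex_vector_space) scale_of_nat_cancel:
  "smul (of_nat (Suc k)) v = smul (of_nat (Suc k)) w \<Longrightarrow> v = w"
  by (metis of_nat_eq_0_iff old.nat.distinct(2) scale_cancel_left)

context vertex_algebra_loc
begin

definition brT :: "'d \<Rightarrow> ('v \<Rightarrow> 'v) \<Rightarrow> 'v \<Rightarrow> 'v" where
  "brT \<alpha> F v = T \<alpha> (F v) - F (T \<alpha> v)"

lemma brT_commute: "brT \<alpha> (brT \<beta> F) = brT \<beta> (brT \<alpha> F)"
  by (rule ext) (simp add: brT_def lin_diff[OF lin_T] T_commute[of \<alpha>])

lemma brT_scale: "brT \<alpha> (\<lambda>v. smul c (F v)) = (\<lambda>v. smul c (brT \<alpha> F v))"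
  using lin_T[of \<alpha>] by (intro ext) (simp add: brT_def lin_iff scale_right_diff_distrib)

lemma brT_sum: "brT \<alpha> (\<lambda>v. \<Sum>i\<in>S. F i v) = (\<lambda>v. \<Sum>i\<in>S. brT \<alpha> (F i) v)"
  by (rule ext) (simp add: brT_def lin_sum[OF lin_T] sum_subtractf)

lemma brT_zero: "brT \<alpha> (\<lambda>v. 0) = (\<lambda>v. 0)"
  by (rule ext) (simp add: brT_def lin_0[OF lin_T])

definition adp :: "('v \<Rightarrow> 'v) \<Rightarrow> nat \<Rightarrow> 'd mi \<Rightarrow> 'v \<Rightarrow> 'v" where
  "adp X k = ((adzT T) ^^ k) (\<lambda>m. if m = mi0 then X else (\<lambda>_. 0))"

lemma adp_Suc: "adp X (Suc k) n v = (\<Sum>\<alpha>\<in>{\<alpha>. 1 \<le> n \<alpha>}. brT \<alpha> (adp X k (n - mi_delta \<alpha>)) v)"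
  by (simp add: adp_def adzT_def brT_def mi_sub_eq)

lemma mi_deg_diff_delta: "1 \<le> n \<alpha> \<Longrightarrow> mi_deg n = Suc (mi_deg (n - mi_delta \<alpha>))"
  using mi_deg_add[of "n - mi_delta \<alpha>" "mi_delta \<alpha>"] mi_diff_delta_add[of n \<alpha>] by simp

lemma adp_homogeneous: "k \<noteq> mi_deg n \<Longrightarrow> adp X k n = (\<lambda>v. 0)"
proof (induction k arbitrary: n)
  case 0
  then have "n \<noteq> 0" by (metis mi_deg_zero)
  then show ?case by (simp add: adp_def mi0_eq)
next
  case (Suc k)
  have "brT \<alpha> (adp X k (n - mi_delta \<alpha>)) v = 0" if "1 \<le> n \<alpha>" for \<alpha> v
  proof -
    have "k \<noteq> mi_deg (n - mi_delta \<alpha>)"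
      using Suc.prems mi_deg_diff_delta[of n \<alpha>, OF that] by simp
    then have "adp X k (n - mi_delta \<alpha>) = (\<lambda>v. 0)" by (rule Suc.IH)
    then show ?thesis by (simp only: brT_zero)
  qed
  then show ?case by (intro ext) (simp add: adp_Suc)
qed

definition adc :: "('v \<Rightarrow> 'v) \<Rightarrow> 'd mi \<Rightarrow> 'v \<Rightarrow> 'v" where
  "adc X n = adp X (mi_deg n) n"

lemma adc_0 [simp]: "adc X 0 = X"
  by (simp add: adc_def adp_def mi0_eq)

lemma adc_rec:
  assumes "mi_deg n = Suc k"
  shows "adc X n v = (\<Sum>\<alpha>\<in>{\<alpha>. 1 \<le> n \<alpha>}. brT \<alpha> (adc X (n - mi_delta \<alpha>)) v)"
  unfolding adc_def assms adp_Suc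
  by (rule sum.cong[OF refl]) (use assms in \<open>auto simp: mi_deg_diff_delta\<close>)

text \<open>Since the operators ad T_alpha commute, \<open>adc X n\<close> is (|n|!/n!) (ad T)^n X.
  The lemma is the resulting ratio of neighbouring coefficients, obtained from the recursion for
  \<open>adc\<close> without multinomial coefficients.\<close>

lemma adc_add_delta:
  "smul (of_nat (n \<alpha> + 1)) (adc X (n + mi_delta \<alpha>) v) = smul (of_nat (mi_deg n + 1)) (brT \<alpha> (adc X n) v)"
proof (induction "mi_deg n" arbitrary: n v \<alpha> rule: less_induct)
  case less
  define S where "S = {\<beta>. \<beta> \<noteq> \<alpha> \<and> 1 \<le> n \<beta>}"
  define d where "d = mi_deg n"
  have IH: "smul (of_nat ((n - mi_delta \<beta>) \<gamma> + 1)) (adc X (n - mi_delta \<beta> + mi_delta \<gamma>) v)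
      = smul (of_nat d) (brT \<gamma> (adc X (n - mi_delta \<beta>)) v)" if "1 \<le> n \<beta>" for \<beta> \<gamma> v
    using less[of "n - mi_delta \<beta>" \<gamma> v] mi_deg_diff_delta[of n \<beta>, OF that] by (simp add: d_def)
  \<comment> \<open>The summand for beta = alpha, absent from \<open>S\<close>, is supplied by the
    second term: the induction hypothesis turns d times \<open>adc X (n - mi_delta alpha)\<close>
    under [T_alpha, -] into n alpha times \<open>adc X n\<close>.\<close>
  have S: "smul (of_nat d) (\<Sum>\<beta>\<in>S. brT \<alpha> (brT \<beta> (adc X (n - mi_delta \<beta>))) v)
    + smul (of_nat (n \<alpha>)) (brT \<alpha> (adc X n) v) = smul (of_nat d) (brT \<alpha> (adc X n) v)"
  proof (cases d)
    case 0
    then have "n = 0" by (simp add: d_def mi_deg_eq_0)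
    then show ?thesis using 0 by simp
  next
    case (Suc k)
    have "adc X n = (\<lambda>v. \<Sum>\<beta>\<in>{\<beta>. 1 \<le> n \<beta>}. brT \<beta> (adc X (n - mi_delta \<beta>)) v)"
      using adc_rec[of n k X] Suc by (auto simp: d_def)
    then have e: "brT \<alpha> (adc X n) v = (\<Sum>\<beta>\<in>{\<beta>. 1 \<le> n \<beta>}. brT \<alpha> (brT \<beta> (adc X (n - mi_delta \<beta>))) v)"
      using brT_sum by metis
    show ?thesis
    proof (cases "1 \<le> n \<alpha>")
      case True
      then have ins: "{\<beta>. 1 \<le> n \<beta>} = insert \<alpha> S" "\<alpha> \<notin> S" by (auto simp: S_def)
      have "(\<lambda>v. smul (of_nat d) (brT \<alpha> (adc X (n - mi_delta \<alpha>)) v)) = (\<lambda>v. smul (of_nat (n \<alpha>)) (adc X n v))"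
        using IH[OF True, of \<alpha>] True by (intro ext) (simp add: mi_diff_delta_add)
      from arg_cong[OF this, of "\<lambda>F. brT \<alpha> F v"]
      have a: "smul (of_nat d) (brT \<alpha> (brT \<alpha> (adc X (n - mi_delta \<alpha>))) v) = smul (of_nat (n \<alpha>)) (brT \<alpha> (adc X n) v)"
        by (simp add: brT_scale)
      have "brT \<alpha> (adc X n) v = brT \<alpha> (brT \<alpha> (adc X (n - mi_delta \<alpha>))) v
          + (\<Sum>\<beta>\<in>S. brT \<alpha> (brT \<beta> (adc X (n - mi_delta \<beta>))) v)"
        unfolding e ins(1) using ins(2) by simp
      from arg_cong[OF this, of "smul (of_nat d)"] show ?thesis
        by (simp only: scale_right_distrib a add.commute)
    next
      case False
      then have "{\<beta>. 1 \<le> n \<beta>} = S" "n \<alpha> = 0" by (auto simp: S_def)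
      then show ?thesis unfolding e by simp
    qed
  qed
  have ins: "{\<beta>. 1 \<le> (n + mi_delta \<alpha>) \<beta>} = insert \<alpha> S" "\<alpha> \<notin> S" by (auto simp: S_def)
  \<comment> \<open>For beta different from alpha, subtracting \<open>mi_delta beta\<close> leaves n
    alpha unchanged, so the hypothesis for the smaller index carries the same weight n alpha +
    1.\<close>
  have t: "smul (of_nat (n \<alpha> + 1)) (brT \<beta> (adc X (n + mi_delta \<alpha> - mi_delta \<beta>)) v)
     = smul (of_nat d) (brT \<alpha> (brT \<beta> (adc X (n - mi_delta \<beta>))) v)" if "\<beta> \<in> S" for \<beta>
  proof -
    have b: "1 \<le> n \<beta>" "\<beta> \<noteq> \<alpha>" using that by (auto simp: S_def)
    have "n + mi_delta \<alpha> - mi_delta \<beta> = n - mi_delta \<beta> + mi_delta \<alpha>" "(n - mi_delta \<beta>) \<alpha> = n \<alpha>"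
      using b by (auto simp: fun_eq_iff)
    then have "(\<lambda>v. smul (of_nat (n \<alpha> + 1)) (adc X (n + mi_delta \<alpha> - mi_delta \<beta>) v))
      = (\<lambda>v. smul (of_nat d) (brT \<alpha> (adc X (n - mi_delta \<beta>)) v))"
      using IH[OF b(1), of \<alpha>] by (intro ext) metis
    from arg_cong[OF this, of "\<lambda>F. brT \<beta> F v"] show ?thesis
      by (simp only: brT_scale brT_commute[of \<alpha> \<beta>])
  qed
  have "adc X (n + mi_delta \<alpha>) v = brT \<alpha> (adc X n) v + (\<Sum>\<beta>\<in>S. brT \<beta> (adc X (n + mi_delta \<alpha> - mi_delta \<beta>)) v)"
    using adc_rec[of "n + mi_delta \<alpha>" d X v] ins by (simp add: mi_deg_add d_def)
  then have "smul (of_nat (n \<alpha> + 1)) (adc X (n + mi_delta \<alpha>) v)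
    = smul (of_nat (n \<alpha> + 1)) (brT \<alpha> (adc X n) v)
     + smul (of_nat d) (\<Sum>\<beta>\<in>S. brT \<alpha> (brT \<beta> (adc X (n - mi_delta \<beta>))) v)"
    by (simp only: scale_right_distrib scale_sum_right) (simp only: t cong: sum.cong)
  also have "\<dots> = brT \<alpha> (adc X n) v + smul (of_nat d) (brT \<alpha> (adc X n) v)"
    unfolding S[symmetric] by (simp add: scale_left_distrib add_ac)
  finally show ?case by (simp add: d_def scale_left_distrib add.commute)
qed

abbreviation ex :: "('v \<Rightarrow> 'v) \<Rightarrow> 'd mi \<Rightarrow> 'v \<Rightarrow> 'v" where "ex X n \<equiv> exp_ad smul T X n"

lemma ex_eq: "ex X n v = smul ((-1) ^ mi_deg n / of_nat (fact (mi_deg n))) (adc X n v)"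
proof -
  have "ex X n v = (\<Sum>k\<in>{..mi_deg n}. smul ((-1) ^ k / of_nat (fact k)) (adp X k n v))"
    by (simp add: exp_ad_def adp_def mi_deg_def)
  also have "\<dots> = (\<Sum>k\<in>{..mi_deg n}. if k = mi_deg n then smul ((-1) ^ k / of_nat (fact k)) (adp X k n v) else 0)"
    by (rule sum.cong) (auto simp: adp_homogeneous)
  finally show ?thesis by (simp add: adc_def)
qed

lemma ex_0 [simp]: "ex X 0 = X"
  by (rule ext) (simp add: ex_eq)

text \<open>Coefficient form of d_alpha X(z) = -[T_alpha, X(z)]: the weight |n| + 1 cancels one
  factor of the factorial. Together with X(0) = X this is all that is used of the exponential from
  here on.\<close>

lemma ex_add_delta: "smul (of_nat (n \<alpha> + 1)) (ex X (n + mi_delta \<alpha>) v) = ex X n (T \<alpha> v) - T \<alpha> (ex X n v)"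
proof -
  let ?d = "mi_deg n"
  have "smul (of_nat (n \<alpha> + 1)) (ex X (n + mi_delta \<alpha>) v)
    = smul ((-1) ^ (?d + 1) / of_nat (fact (?d + 1))) (smul (of_nat (n \<alpha> + 1)) (adc X (n + mi_delta \<alpha>) v))"
    by (simp only: ex_eq mi_deg_add mi_deg_delta scale_scale mult.commute)
  also have "\<dots> = smul ((-1) ^ (?d + 1) / of_nat (fact (?d + 1)) * of_nat (?d + 1)) (brT \<alpha> (adc X n) v)"
    by (simp only: adc_add_delta scale_scale)
  also have "(-1) ^ (?d + 1) / of_nat (fact (?d + 1)) * of_nat (?d + 1) = - ((-1) ^ ?d / of_nat (fact ?d) :: complex)"
  proof -
    have "of_nat (fact (?d + 1)) = of_nat (?d + 1) * (of_nat (fact ?d) :: complex)" 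
      by (simp only: fact_Suc Suc_eq_plus1[symmetric] of_nat_mult of_nat_id)
    moreover have "of_nat (?d + 1) \<noteq> (0 :: complex)" by (simp only: of_nat_eq_0_iff)
    moreover have "- u / (k * f) * k = - (u / f)" if "k \<noteq> 0" for u f k :: complex
      using that by simp
    ultimately show ?thesis by (simp only: power_add power_one_right mult_minus1_right)
  qed
  also have "smul \<dots> (brT \<alpha> (adc X n) v) = - brT \<alpha> (ex X n) v"
    using brT_scale[of \<alpha> "(-1) ^ ?d / of_nat (fact ?d)" "adc X n"] by (simp add: ex_eq[abs_def])
  finally show ?thesis unfolding brT_def minus_diff_eq .
qed

lemma ex_linear:
  assumes "lin X" shows "lin (ex X n)"
proof (induction n rule: mi_induct)
  case (add m a)
  have e: "smul (of_nat (Suc (m a))) (ex X (m + mi_delta a) v) = ex X m (T a v) - T a (ex X m v)" for v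
    using ex_add_delta[of m a X v] by (simp only: Suc_eq_plus1)
  show ?case unfolding lin_iff
  proof (intro conjI allI)
    fix v w
    show "ex X (m + mi_delta a) (v + w) = ex X (m + mi_delta a) v + ex X (m + mi_delta a) w"
      by (rule scale_of_nat_cancel[of "m a"])
        (use add lin_T[of a] in \<open>simp only: scale_right_distrib e lin_iff add_diff_add\<close>)
  next
    fix c v
    have "smul (of_nat (Suc (m a))) (ex X (m + mi_delta a) (smul c v))
      = smul c (smul (of_nat (Suc (m a))) (ex X (m + mi_delta a) v))"
      using add lin_T[of a] by (simp only: e lin_iff scale_right_diff_distrib)
    also have "\<dots> = smul (of_nat (Suc (m a))) (smul c (ex X (m + mi_delta a) v))"
      by (rule scale_left_commute)
    finally show "ex X (m + mi_delta a) (smul c v) = smul c (ex X (m + mi_delta a) v)"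
      by (rule scale_of_nat_cancel)
  qed
qed (simp add: assms)

section \<open>The action on the vacuum\<close>

text \<open>\<open>E n a\<close> is the coefficient of \<open>z^n\<close> in \<open>Y(a,z)1 = e^{z.T} a\<close>.\<close>

definition E :: "'d mi \<Rightarrow> 'v \<Rightarrow> 'v" where
  "E n a = (SOME g. ls_eq smul (Y a vac) (0, g) \<and> g mi0 = a) n"

lemma Y_E: "ls_eq smul (Y a vac) (0, \<lambda>n. E n a)" and E_0 [simp]: "E 0 a = a"
  using someI_ex[OF Y_on_vac[of a]] by (simp_all add: E_def[abs_def] mi0_eq)

lemma regular_iff: "ls_eq smul u (0, g) \<longleftrightarrow> (\<forall>\<^sub>F N in sequentially. nu u N = cmul smul (ss_pow zsq N) g)"
  by (simp add: eventually_ls_eq nu_pair)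

lemma nu_Y_vac: "\<forall>\<^sub>F N in sequentially. nu (Y a vac) N = cmul smul (ss_pow zsq N) (\<lambda>n. E n a)"
  using Y_E regular_iff by blast

text \<open>As 1 is even, X 1 = 0 makes both parity parts of X kill 1, and only X Y(a,z) 1 remains
  of the commutator.\<close>

lemma scomm_vac:
  assumes X: "lin X" and "X vac = 0"
  shows "ls_eq smul (scomm smul P X (Y a) vac) (0, \<lambda>n. X (E n a))"
proof -
  have o: "op_even smul P X vac = 0" "op_odd smul P X vac = 0"
    using assms by (simp_all add: op_even_def op_odd_def)
  show ?thesis unfolding regular_iff
    using nu_scomm[OF X, of "Y a" vac] nu_Y_vac[of a] ls_linear_0[OF Y_linear, of a]
    by eventually_elim (simp add: o cmul_map[OF X])
qed

text \<open>Translation covariance applied to 1, where T_alpha vanishes, gives d_alpha Y(a,z)1 =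
  T_alpha Y(a,z)1.\<close>

lemma E_add_delta: "smul (of_nat (n \<alpha> + 1)) (E (n + mi_delta \<alpha>) a) = T \<alpha> (E n a)"
proof -
  have "ls_eq smul (0, \<lambda>n. T \<alpha> (E n a)) (0, dif \<alpha> (\<lambda>n. E n a))"
    using ls_eq_trans[OF ls_eq_trans[OF ls_eq_sym[OF scomm_vac[OF lin_T T_vac]] translation] ls_deriv_regular[OF Y_E]] .
  then have "(\<lambda>n. T \<alpha> (E n a)) = dif \<alpha> (\<lambda>n. E n a)" by (rule ls_eq_numerator_unique)
  then have "T \<alpha> (E n a) = dif \<alpha> (\<lambda>n. E n a) n" by (rule fun_cong)
  then show ?thesis by (simp add: dif_def)
qed

text \<open>\<open>E\<close> comes from a choice made separately for each a, so linearity is read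
  off from its recursion, starting at \<open>E 0 a = a\<close>.\<close>

lemma E_linear: "lin (E n)"
proof (induction n rule: mi_induct)
  case (add m a)
  have e: "smul (of_nat (Suc (m a))) (E (m + mi_delta a) v) = T a (E m v)" for v
    using E_add_delta[of m a v] by (simp only: Suc_eq_plus1)
  show ?case unfolding lin_iff
  proof (intro conjI allI)
    fix v w
    show "E (m + mi_delta a) (v + w) = E (m + mi_delta a) v + E (m + mi_delta a) w"
      by (rule scale_of_nat_cancel[of "m a"])
        (use add lin_T[of a] in \<open>simp only: scale_right_distrib e lin_iff\<close>)
  next
    fix c v
    have "smul (of_nat (Suc (m a))) (E (m + mi_delta a) (smul c v))
      = smul c (smul (of_nat (Suc (m a))) (E (m + mi_delta a) v))"
      using add lin_T[of a] by (simp only: e lin_iff)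
    also have "\<dots> = smul (of_nat (Suc (m a))) (smul c (E (m + mi_delta a) v))"
      by (rule scale_left_commute)
    finally show "E (m + mi_delta a) (smul c v) = smul c (E (m + mi_delta a) v)"
      by (rule scale_of_nat_cancel)
  qed
qed (simp add: lin_iff)

lemma E_T: "E n (T \<alpha> a) = T \<alpha> (E n a)"
proof (induction n rule: mi_induct)
  case (add m b)
  show ?case
  proof (rule scale_of_nat_cancel[of "m b"])
    have "smul (of_nat (Suc (m b))) (E (m + mi_delta b) (T \<alpha> a)) = T b (T \<alpha> (E m a))"
      using E_add_delta[of m b "T \<alpha> a"] add by simp
    also have "\<dots> = T \<alpha> (T b (E m a))" by (rule T_commute)
    also have "\<dots> = T \<alpha> (smul (of_nat (Suc (m b))) (E (m + mi_delta b) a))"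
      using E_add_delta[of m b a] by simp
    finally show "smul (of_nat (Suc (m b))) (E (m + mi_delta b) (T \<alpha> a))
      = smul (of_nat (Suc (m b))) (T \<alpha> (E (m + mi_delta b) a))"
      using lin_T[of \<alpha>] by (simp only: lin_iff)
  qed
qed simp

text \<open>Both sides are the coefficients of operator series \<open>F(z)\<close> with \<open>\<partial>\<^sub>\<alpha> F = F T\<^sub>\<alpha>\<close> and \<open>F(0) = X\<close>.\<close>

lemma E_ex:
  assumes X: "lin X"
  shows "(\<Sum>n\<in>{n. n \<le> m}. E (m - n) (ex X n a)) = X (E m a)"
proof (induction m arbitrary: a rule: mi_induct)
  case zero
  have "{n :: 'd mi. n \<le> 0} = {0}" by auto
  then show ?case by simp
next
  case (add m \<alpha>)
  have x: "smul (of_nat (n \<alpha> + 1)) (E k (ex X (n + mi_delta \<alpha>) a)) = E k (ex X n (T \<alpha> a)) - T \<alpha> (E k (ex X n a))"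
    for n k
  proof -
    have "smul (of_nat (n \<alpha> + 1)) (E k (ex X (n + mi_delta \<alpha>) a))
      = E k (smul (of_nat (n \<alpha> + 1)) (ex X (n + mi_delta \<alpha>) a))"
      using E_linear[of k] by (simp only: lin_iff)
    then show ?thesis by (simp only: ex_add_delta lin_diff[OF E_linear] E_T)
  qed
  have "smul (of_nat (m \<alpha> + 1)) (\<Sum>n\<in>{n. n \<le> m + mi_delta \<alpha>}. E (m + mi_delta \<alpha> - n) (ex X n a))
    = (\<Sum>n\<in>{n. n \<le> m}. T \<alpha> (E (m - n) (ex X n a)))
      + (\<Sum>n\<in>{n. n \<le> m}. E (m - n) (ex X n (T \<alpha> a)) - T \<alpha> (E (m - n) (ex X n a)))"
    using sum_mi_leibniz[of m \<alpha> "\<lambda>n k. E k (ex X n a)"] by (simp only: x E_add_delta)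
  \<comment> \<open>The terms with T_alpha on the outside, one from each factor of the product rule,
    cancel; what is left is the induction hypothesis at T_alpha a.\<close>
  also have "\<dots> = (\<Sum>n\<in>{n. n \<le> m}. E (m - n) (ex X n (T \<alpha> a)))"
    by (simp add: sum_subtractf)
  also have "\<dots> = X (E m (T \<alpha> a))" by (rule add)
  also have "\<dots> = X (T \<alpha> (E m a))" by (simp only: E_T)
  also have "\<dots> = smul (of_nat (m \<alpha> + 1)) (X (E (m + mi_delta \<alpha>) a))"
    using X E_add_delta[of m \<alpha> a] by (metis lin_iff)
  finally have "smul (of_nat (Suc (m \<alpha>))) (\<Sum>n\<in>{n. n \<le> m + mi_delta \<alpha>}. E (m + mi_delta \<alpha> - n) (ex X n a))
    = smul (of_nat (Suc (m \<alpha>))) (X (E (m + mi_delta \<alpha>) a))"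
    unfolding Suc_eq_plus1 .
  then show ?case by (rule scale_of_nat_cancel)
qed

text \<open>e^{z.T} has constant term 1, so the system is triangular in the degree: the summand n =
  m is x m itself, and the others involve lower degrees.\<close>

lemma E_convolution_inj:
  assumes "\<And>m. (\<Sum>n\<in>{n. n \<le> m}. E (m - n) (x n)) = (\<Sum>n\<in>{n. n \<le> m}. E (m - n) (y n))"
  shows "x m = y m"
proof (induction "mi_deg m" arbitrary: m rule: less_induct)
  case less
  have "x n = y n" if "n \<in> {n. n \<le> m} - {m}" for n
  proof -
    have "n + (m - n) = m" "m - n \<noteq> 0" using that by (auto, metis add.right_neutral mi_add_diff(1))
    then have "mi_deg n < mi_deg m" by (metis mi_deg_add mi_deg_eq_0 less_add_same_cancel1 neq0_conv)
    then show ?thesis by (rule less)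
  qed
  then have "(\<Sum>n\<in>{n. n \<le> m} - {m}. E (m - n) (x n)) = (\<Sum>n\<in>{n. n \<le> m} - {m}. E (m - n) (y n))"
    by simp
  moreover have "m - m = 0" by (rule ext) simp
  ultimately show ?case
    using assms[of m] by (simp add: sum.remove[of "{n. n \<le> m}" m])
qed

lemma Ysub_eq: "Ysub smul Y g b = Ysum {n. g n \<noteq> 0} g b"
  by (simp add: Ysub_def)

lemma Ysub_vac:
  assumes fin: "finite {n. g n \<noteq> 0}"
  shows "ls_eq smul (Ysub smul Y g vac) (0, \<lambda>m. \<Sum>n\<in>{n. n \<le> m}. E (m - n) (g n))"
proof -
  let ?S = "{n. g n \<noteq> 0}"
  have e: "(\<lambda>m. \<Sum>n\<in>{n. n \<le> m}. E (m - n) (g n)) = (\<Sum>n\<in>?S. cmul smul (smono n) (\<lambda>k. E k (g n)))"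
  proof
    fix m
    have "(\<Sum>n\<in>{n. n \<le> m}. E (m - n) (g n)) = (\<Sum>n\<in>?S \<inter> {n. n \<le> m}. E (m - n) (g n))"
      by (rule sum.mono_neutral_right) (auto simp: lin_0[OF E_linear])
    also have "\<dots> = (\<Sum>n\<in>?S. if n \<le> m then E (m - n) (g n) else 0)"
      by (simp add: sum.inter_restrict[OF fin])
    finally show "(\<Sum>n\<in>{n. n \<le> m}. E (m - n) (g n)) = (\<Sum>n\<in>?S. cmul smul (smono n) (\<lambda>k. E k (g n))) m"
      by (simp add: sum_fun_apply cmul_smono)
  qed
  have "\<forall>\<^sub>F N in sequentially. \<forall>n\<in>?S. nu (Y (g n) vac) N = cmul smul (ss_pow zsq N) (\<lambda>k. E k (g n))"
    using fin nu_Y_vac by (intro eventually_ball_finite) auto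
  then show ?thesis unfolding regular_iff Ysub_eq e using nu_Ysum[OF fin, of g vac]
    by eventually_elim (simp add: cmul_sum cmul_commute)
qed

section \<open>Uniqueness\<close>

lemma cmul_zsq_pow_low: "mi_deg n < 2 * M \<Longrightarrow> cmul smul (ss_pow zsq M) g n = 0"
  for g :: "'d mi \<Rightarrow> 'v"
proof (induction M arbitrary: n)
  case (Suc M)
  have "cmul smul (ss_pow zsq M) g (n - mi_scale 2 (mi_delta i)) = 0" if "2 \<le> n i" for i
  proof (rule Suc.IH)
    have "n = n - mi_scale 2 (mi_delta i) + (mi_delta i + mi_delta i)"
      using that by (auto simp: fun_eq_iff mi_scale_def)
    then have "mi_deg n = mi_deg (n - mi_scale 2 (mi_delta i)) + 2"
      by (metis mi_deg_add mi_deg_delta one_add_one)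
    then show "mi_deg (n - mi_scale 2 (mi_delta i)) < 2 * M" using Suc.prems by simp
  qed
  then show ?case
    unfolding cmul_pow_Suc zsq_def cmul_ssq by (intro sum.neutral) simp
qed simp

text \<open>By degree only g 0 can contribute, and the pure power (z^i)^(2 M) occurs in (z^2)^M with
  coefficient 1.\<close>

lemma cmul_zsq_pow_diagonal: "cmul smul (ss_pow zsq M) g (mi_scale (2 * M) (mi_delta i)) = g 0"
  for g :: "'d mi \<Rightarrow> 'v"
proof (induction M)
  case 0
  have "mi_scale 0 (mi_delta i) = 0" by (rule ext) (simp add: mi_scale_def)
  then show ?case by (simp only: mult_0_right ss_pow_0 cmul_one)
next
  case (Suc M)
  let ?n = "mi_scale (2 * Suc M) (mi_delta i)"
  let ?h = "cmul smul (ss_pow zsq M) g"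
  have d: "?n - mi_scale 2 (mi_delta i) = mi_scale (2 * M) (mi_delta i)"
    by (rule ext) (simp add: mi_scale_def)
  have "cmul smul (ss_pow zsq (Suc M)) g ?n
    = (\<Sum>j\<in>UNIV. if 2 \<le> ?n j then ?h (?n - mi_scale 2 (mi_delta j)) else 0)"
    unfolding cmul_pow_Suc zsq_def cmul_ssq ..
  also have "\<dots> = (\<Sum>j\<in>UNIV. if j = i then ?h (?n - mi_scale 2 (mi_delta j)) else 0)"
    by (rule sum.cong) (auto simp: mi_scale_def)
  also have "\<dots> = ?h (?n - mi_scale 2 (mi_delta i))" by simp
  finally show ?case by (simp only: d Suc)
qed

lemma mi_deg_scale_delta: "mi_deg (mi_scale k (mi_delta i)) = k"
  by (simp add: mi_deg_def mi_scale_def flip: sum_distrib_left)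

text \<open>With \<open>u = Y(b,w)1\<close> regular at \<open>w = 0\<close>, the coefficient of \<open>(w\<^sup>i)^(2 M)\<close> of the numerator reads off
  \<open>(z^2)^L (A(z) - B(z)) b\<close>: all other contributions are divisible by a positive power of \<open>w\<close>.\<close>

lemma fcomp_eq_at_origin:
  fixes g :: "'d mi \<Rightarrow> 'v"
  assumes W: "weq (fmul (ss_pow xydiff_sq L) (fcomp A u - fcomp B u)) 0"
    and u: "ls_eq smul u (0, g)" and AB0: "ls_eq smul (A 0) (B 0)"
  shows "ls_eq smul (A (g 0)) (B (g 0))"
proof -
  define D where "D = fcomp A (0, g) - fcomp B (0, g)"
  have "weq D (fcomp A u - fcomp B u)"
    unfolding D_def by (intro weq_diff fcomp_cong_right ls_eq_sym[OF u])
  then have "weq (fmul (ss_pow xydiff_sq L) D) 0"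
    using weq_trans[OF weq_fmul W] by blast
  then obtain M where M: "sleq (fmul (ss_pow xydiff_sq L) D M) 0"
    unfolding weq_def eventually_sequentially by (metis order_refl zero_fun_apply)
  \<comment> \<open>\<open>undefined\<close> merely names some coordinate. The degree 2 M is the
    lowest in which the numerator of u over (w^2)^M can be nonzero.\<close>
  define n0 :: "'d mi" where "n0 = mi_scale (2 * M) (mi_delta undefined)"
  have s0: "slice (D M N) m = nu (A (cmul smul (ss_pow zsq M) g m)) N - nu (B (cmul smul (ss_pow zsq M) g m)) N"
    for N m
    by (simp add: D_def slice_diff slice_fcomp nu_pair)
  have low: "cmul smul (ss_pow zsq M) g (n0 - m) = 0" if "m \<le> n0" "m \<noteq> 0" for m
  proof (rule cmul_zsq_pow_low)
    have "mi_deg m + mi_deg (n0 - m) = 2 * M"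
      using that mi_deg_add[of m "n0 - m"] by (simp add: n0_def mi_deg_scale_delta)
    moreover have "mi_deg m \<noteq> 0" using that by (simp add: mi_deg_eq_0)
    ultimately show "mi_deg (n0 - m) < 2 * M" by simp
  qed
  have "\<forall>\<^sub>F N in sequentially. slice (fmul (ss_pow xydiff_sq L) D M N) n0 = 0"
    using M by (simp add: sleq_def)
  then show ?thesis
    using AB0 unfolding eventually_ls_eq
  proof eventually_elim
    case (elim N)
    \<comment> \<open>For nonzero m the inner coefficient is 0, so the slice of \<open>D\<close> is
      the difference of A and B at 0. For m = 0 the locality factor is evaluated at w = 0.\<close>
    have "cmul smul (slice (ss_pow xydiff_sq L) m) (slice (D M N) (n0 - m))
      = (if m = 0 then cmul smul (ss_pow zsq L) (slice (D M N) n0) else 0)" if "m \<le> n0" for m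
      using that elim by (cases "m = 0") (simp_all add: slice_0_ss_pow slice_0_xydiff_sq s0 low)
    then have "slice (fmul (ss_pow xydiff_sq L) D M N) n0
      = (\<Sum>m\<in>{m. m \<le> n0}. if m = 0 then cmul smul (ss_pow zsq L) (slice (D M N) n0) else 0)"
      unfolding fmul_def slice_cmul by (intro sum.cong) auto
    also have "\<dots> = cmul smul (ss_pow zsq L) (slice (D M N) n0)" by (simp add: sum.delta)
    finally have "cmul smul (ss_pow zsq L) (slice (D M N) n0) = cmul smul (ss_pow zsq L) 0"
      using elim by simp
    then have "slice (D M N) n0 = 0" by (rule cmul_zsq_pow_inj)
    then show ?case by (simp add: s0 n0_def cmul_zsq_pow_diagonal)
  qed
qed

lemma loc2_diff:
  fixes G1 :: "('d,'v) fam"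
  assumes "loc2 L G1 G1'" "loc2 L G2 G2'" shows "loc2 L (G1 - G2) (G1' - G2')"
proof -
  have e: "G - H = G + fscale (-1) H" for G H :: "('d,'v) fam"
    by (intro ext) (simp add: fscale_def)
  show ?thesis unfolding e by (intro loc2_add loc2_fscale assms)
qed

lemma fields_equal:
  assumes A: "locfam (\<lambda>c. fcomp A (Y b c)) (\<lambda>c. swapped (Y b) A c)"
    and B: "locfam (\<lambda>c. fcomp B (Y b c)) (\<lambda>c. swapped (Y b) B c)"
    and vac: "ls_eq smul (A vac) (B vac)" and AB0: "ls_eq smul (A 0) (B 0)"
  shows "ls_eq smul (A b) (B b)"
proof -
  obtain L1 L2 where L: "\<And>c. loc2 L1 (fcomp A (Y b c)) (swapped (Y b) A c)"
    "\<And>c. loc2 L2 (fcomp B (Y b c)) (swapped (Y b) B c)"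
    using A B by (auto simp: locfam_def)
  define L where "L = max L1 L2"
  have "loc2 L (fcomp A (Y b vac) - fcomp B (Y b vac)) (swapped (Y b) A vac - swapped (Y b) B vac)"
    using loc2_mono[OF L(1)] loc2_mono[OF L(2)] by (intro loc2_diff) (auto simp: L_def)
  moreover have "weq (swapped (Y b) A vac - swapped (Y b) B vac) 0"
    using weq_diff[OF swapped_vac_cong[of A B, OF vac Y_linear[of b] fld_conj_Y_linear[of b]] weq_refl, of "swapped (Y b) B vac"]
    by simp
  ultimately have "loc2 L (fcomp A (Y b vac) - fcomp B (Y b vac)) 0"
    using loc2_cong weq_refl by blast
  then obtain K h where h: "weq (fmul (ss_pow xydiff_sq L) (fcomp A (Y b vac) - fcomp B (Y b vac))) (rep K h)"
    "weq (fmul (ss_pow xydiff_sq L) 0) (rep K (swp h))"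
    by (auto simp: loc2_def)
  \<comment> \<open>Locality gives a single h for both orders. The reversed order vanishes on the
    vacuum, which forces h = 0 and hence kills the direct order as well.\<close>
  have "swp h = 0" using weq_sym[OF h(2)] by (intro rep_eq_0D) simp
  then have "h = 0" by (metis swp_swp swp_zero)
  then have "weq (fmul (ss_pow xydiff_sq L) (fcomp A (Y b vac) - fcomp B (Y b vac))) 0"
    using h(1) by simp
  from fcomp_eq_at_origin[OF this Y_E AB0] show ?thesis by simp
qed

section \<open>Commutators of endomorphisms with fields\<close>

lemma Ysub_locfam:
  assumes "finite {n. g n \<noteq> 0}" "\<And>v. ls_eq smul (A v) (Ysub smul Y g v)"
  shows "locfam (\<lambda>c. fcomp A (Y b c)) (\<lambda>c. swapped (Y b) A c)"
  using locfam_Ysum[OF assms(1), of A g b] assms(2) by (simp add: Ysub_eq)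

lemma commutator_of_local:
  assumes X: "lin X" and loc: "local_op smul P Y X" and vac: "X vac = 0"
    and fin: "finite {n. ex X n a \<noteq> 0}"
  shows "ls_eq smul (scomm smul P X (Y a) b) (Ysub smul Y (\<lambda>n. ex X n a) b)"
proof (rule fields_equal)
  show "locfam (\<lambda>c. fcomp (scomm smul P X (Y a)) (Y b c)) (\<lambda>c. swapped (Y b) (scomm smul P X (Y a)) c)"
    using loc local_op_iff[OF X] by blast
  show "locfam (\<lambda>c. fcomp (Ysub smul Y (\<lambda>n. ex X n a)) (Y b c)) (\<lambda>c. swapped (Y b) (Ysub smul Y (\<lambda>n. ex X n a)) c)"
    by (rule Ysub_locfam[OF fin]) simp
  show "ls_eq smul (scomm smul P X (Y a) vac) (Ysub smul Y (\<lambda>n. ex X n a) vac)"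
    using scomm_vac[OF X vac] ls_eq_sym[OF Ysub_vac[OF fin, unfolded E_ex[OF X]]] by (rule ls_eq_trans)
  have "\<forall>\<^sub>F N in sequentially. \<forall>n\<in>{n. ex X n a \<noteq> 0}. nu (Y (ex X n a) 0) N = 0"
    using fin ls_linear_0[OF Y_linear] by (intro eventually_ball_finite) auto
  then have "\<forall>\<^sub>F N in sequentially. nu (Ysub smul Y (\<lambda>n. ex X n a) 0) N = 0"
    unfolding Ysub_eq using nu_Ysum[OF fin, of "\<lambda>n. ex X n a" 0]
    by eventually_elim simp
  then show "ls_eq smul (scomm smul P X (Y a) 0) (Ysub smul Y (\<lambda>n. ex X n a) 0)"
    unfolding eventually_ls_eq using ls_linear_0[OF scomm_linear[OF X Y_linear], of a]
    by eventually_elim simp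
qed

section \<open>Consequences of condition (ii)\<close>

context
  fixes X :: "'v \<Rightarrow> 'v" and Xz :: "'v \<Rightarrow> 'd mi \<Rightarrow> 'v"
  assumes X: "lin X" and fin: "\<And>a. finite {n. Xz a n \<noteq> 0}" and Xz_0: "\<And>a. Xz a mi0 = X a"
    and comm: "\<And>a b. ls_eq smul (scomm smul P X (Y a) b) (Ysub smul Y (Xz a) b)"
begin

text \<open>Y(1,z) is the identity and supercommutes with X, so e^{z.T} X(z) 1 = 0; its constant
  term is X(0) 1 = X 1.\<close>

lemma commutator_kills_vac: "X vac = 0"
proof -
  have v: "\<forall>\<^sub>F N in sequentially. nu (Y vac c) N = cmul smul (ss_pow zsq N) (\<lambda>n. if n = 0 then c else 0)" for c
    using Y_vac[of c] by (simp add: regular_iff mi0_eq)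
  let ?e = "op_even smul P X vac" and ?o = "op_odd smul P X vac"
  have "\<forall>\<^sub>F N in sequentially. nu (scomm smul P X (Y vac) vac) N = 0"
    using nu_scomm[OF X, of "Y vac" vac] v[of vac] v[of ?e] v[of "s ?o"]
  proof eventually_elim
    case (elim N)
    let ?c = "\<lambda>v. cmul smul (ss_pow zsq N) (\<lambda>n. if n = 0 then v else 0)"
    have l: "?c (f v) n = f (?c v n)" if "lin f" for f v n
    proof -
      have e: "(\<lambda>n. if n = 0 then f v else 0) = (\<lambda>n. f (if n = 0 then v else 0))"
        using lin_0[OF that] by (intro ext) simp
      show ?thesis unfolding e cmul_map[OF that] ..
    qed
    \<comment> \<open>The even and odd parts of X 1 recombine to X 1, since the sign twist on the
      odd part is undone by s (s v) = v.\<close>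
    have eo: "(\<lambda>n. if n = 0 then ?e else 0) + (\<lambda>n. if n = 0 then ?o else 0) = (\<lambda>n. if n = 0 then X vac else 0)"
      by (rule ext) (simp add: op_even_plus_odd)
    have t1: "?c ?e n + ?c ?o n = ?c (X vac) n" for n
      unfolding eo[symmetric] cmul_add plus_fun_apply ..
    have t2: "X (?c vac n) = ?c (X vac) n" "s (?c (s ?o) n) = ?c ?o n" for n
      using l[OF X, of vac n] l[OF lin_s, of "s ?o" n] by (simp_all only: s_s)
    show ?case unfolding elim by (intro ext) (simp only: t2 t1 diff_self zero_fun_apply)
  qed
  then have "\<forall>\<^sub>F N in sequentially. nu (Ysub smul Y (Xz vac) vac) N = cmul smul (ss_pow zsq N) 0"
    using comm[of vac vac, unfolded eventually_ls_eq] by eventually_elim simp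
  then have "ls_eq smul (Ysub smul Y (Xz vac) vac) (0, 0)" by (simp add: regular_iff)
  then have "(\<lambda>m. \<Sum>n\<in>{n. n \<le> m}. E (m - n) (Xz vac n)) = 0"
    by (rule ls_eq_numerator_unique[OF ls_eq_trans[OF ls_eq_sym[OF Ysub_vac[OF fin]]]])
  from fun_cong[OF this, of 0] have "(\<Sum>n\<in>{n. n \<le> 0}. E (0 - n) (Xz vac n)) = 0"
    by (simp only: zero_fun_apply)
  moreover have "{n :: 'd mi. n \<le> 0} = {0}" by auto
  ultimately show ?thesis using Xz_0 by (simp add: mi0_eq)
qed

lemma commutator_determines: "Xz a n = ex X n a"
proof (rule E_convolution_inj)
  fix m
  have "(\<lambda>m. \<Sum>n\<in>{n. n \<le> m}. E (m - n) (Xz a n)) = (\<lambda>m. X (E m a))"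
    using ls_eq_trans[OF ls_eq_sym[OF Ysub_vac[OF fin]] ls_eq_trans[OF ls_eq_sym[OF comm] scomm_vac[OF X commutator_kills_vac]]]
    by (rule ls_eq_numerator_unique)
  then show "(\<Sum>n\<in>{n. n \<le> m}. E (m - n) (Xz a n)) = (\<Sum>n\<in>{n. n \<le> m}. E (m - n) (ex X n a))"
    by (metis E_ex[OF X])
qed

text \<open>By (ii) the field [X,Y(a,z)] is equivalent to a finite sum of fields z^n Y(x,z), which
  is local with respect to every Y(b,w).\<close>

lemma commutator_local: "local_op smul P Y X"
  unfolding local_op_iff[OF X] using Ysub_locfam[OF fin comm] by blast

end

end


section \<open>Equivalence of (i) and (ii), and uniqueness of X(z)\<close>

theorem mainTheorem1:
  fixes smul :: "complex \<Rightarrow> 'v::ab_group_add \<Rightarrow> 'v"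
    and P :: "'v \<Rightarrow> 'v"
    and Y :: "'v \<Rightarrow> 'v \<Rightarrow> ('d::finite, 'v) ls"
    and T :: "'d \<Rightarrow> 'v \<Rightarrow> 'v"
    and vac :: 'v
    and X :: "'v \<Rightarrow> 'v"
  assumes VA: "vertex_algebra smul P Y T vac"
    and X_lin: "Vector_Spaces.linear smul smul X"
  shows "((local_op smul P Y X \<and> X vac = 0 \<and> (\<forall>a. finite {n. exp_ad smul T X n a \<noteq> 0}))
         \<longleftrightarrow>
         (\<exists>Xz :: 'v \<Rightarrow> 'd mi \<Rightarrow> 'v.
            (\<forall>n. Vector_Spaces.linear smul smul (\<lambda>a. Xz a n)) \<and>
            (\<forall>a. finite {n. Xz a n \<noteq> 0}) \<and>
            (\<forall>a. Xz a mi0 = X a) \<and>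
            (\<forall>a b. ls_eq smul (scomm smul P X (Y a) b) (Ysub smul Y (Xz a) b))))
    \<and> (\<forall>Xz :: 'v \<Rightarrow> 'd mi \<Rightarrow> 'v.
            ((\<forall>n. Vector_Spaces.linear smul smul (\<lambda>a. Xz a n)) \<and>
             (\<forall>a. finite {n. Xz a n \<noteq> 0}) \<and>
             (\<forall>a. Xz a mi0 = X a) \<and>
             (\<forall>a b. ls_eq smul (scomm smul P X (Y a) b) (Ysub smul Y (Xz a) b)))
            \<longrightarrow> (\<forall>a n. Xz a n = exp_ad smul T X n a))
    \<and> ((local_op smul P Y X \<and> X vac = 0 \<and> (\<forall>a. finite {n. exp_ad smul T X n a \<noteq> 0}))
         \<longrightarrow> (\<forall>a b. ls_eq smul (scomm smul P X (Y a) b) (Ysub smul Y (\<lambda>n. exp_ad smul T X n a) b)))"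
proof -
  interpret vertex_algebra_loc smul P Y T vac
    using VA by (simp add: vertex_algebra_loc_def vertex_algebra_loc_axioms_def complex_vector_space_def
        vertex_algebra_def is_superspace_def)
  let ?i = "local_op smul P Y X \<and> X vac = 0 \<and> (\<forall>a. finite {n. exp_ad smul T X n a \<noteq> 0})"
  let ?Q = "\<lambda>Xz :: 'v \<Rightarrow> 'd mi \<Rightarrow> 'v.
    (\<forall>n. Vector_Spaces.linear smul smul (\<lambda>a. Xz a n)) \<and>
    (\<forall>a. finite {n. Xz a n \<noteq> 0}) \<and>
    (\<forall>a. Xz a mi0 = X a) \<and>
    (\<forall>a b. ls_eq smul (scomm smul P X (Y a) b) (Ysub smul Y (Xz a) b))"
  have comm: "ls_eq smul (scomm smul P X (Y a) b) (Ysub smul Y (\<lambda>n. exp_ad smul T X n a) b)" if ?i for a b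
    using that by (intro commutator_of_local[OF X_lin]) auto
  have exi: "?Q (\<lambda>a n. exp_ad smul T X n a)" if ?i
    using that comm[OF that] ex_linear[OF X_lin] by (auto simp: mi0_eq)
  have det: "Xz a n = exp_ad smul T X n a" if "?Q Xz" for Xz a n
    using that by (intro commutator_determines[OF X_lin]) auto
  have i: ?i if q: "?Q Xz" for Xz
  proof (intro conjI allI)
    show "local_op smul P Y X" using q by (intro commutator_local[OF X_lin, of Xz]) auto
    show "X vac = 0" using q by (intro commutator_kills_vac[OF X_lin, of Xz]) auto
    fix a
    have "finite {n. Xz a n \<noteq> 0}" using q by blast
    then show "finite {n. exp_ad smul T X n a \<noteq> 0}" by (simp only: det[OF q])
  qed
  have "?i \<longleftrightarrow> (\<exists>Xz. ?Q Xz)"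
  proof
    assume ?i
    from exi[OF this] show "\<exists>Xz. ?Q Xz" by (rule exI[where x = "\<lambda>a n. exp_ad smul T X n a"])
  next
    assume "\<exists>Xz. ?Q Xz"
    then obtain Xz where "?Q Xz" ..
    then show ?i by (rule i)
  qed
  moreover have "\<forall>Xz. ?Q Xz \<longrightarrow> (\<forall>a n. Xz a n = exp_ad smul T X n a)"
    by (intro allI impI) (rule det)
  moreover have "?i \<longrightarrow> (\<forall>a b. ls_eq smul (scomm smul P X (Y a) b) (Ysub smul Y (\<lambda>n. exp_ad smul T X n a) b))"
    by (intro allI impI) (rule comm)
  ultimately show ?thesis by (intro conjI)
qed

end
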